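(* Let $M$ be an $(r,s)$-leaper, $r\le s$, $o$ one of the characters $\mathtt f$, $\mathtt g$, and $\mathtt h$ such that there exists an initial cycle of $M$ of type $o$, and $e=e_1e_2\ldots e_l$ a string composed of the characters $\mathtt f$, $\mathtt g$, $\mathtt h$, and $\hbar$. Then the board $B^M_o(e)$ is dual with respect to $M$ and $L^M_o(e)$.
   Context: Leapers and dual boards. Squares of the infinite chessboard are identified with their centers, the points of $\mathbb Z^2$; a board is a set of squares. For nonnegative integers $p,q$, not both zero, a $(p,q)$-leaper is a piece that moves from a square $a$ to any of $a+(\pm p,\pm q)$, $a+(\pm q,\pm p)$; a $(p,q)$-leaper and a $(q,p)$-leaper are the same leaper. The leaper graph of $L$ over a board $B$ has the squares of $B$ as vertices, two being adjacent when a move of $L$ joins them. A board $B$ is dual with respect to two distinct leapers $L$ and $M$ if $B$ contains more than one square and the leaper graphs of $L$ and $M$ over $B$ are connected and isomorphic. Initial cycles. Number the directions $\mathtt E,\mathtt{NE},\mathtt N,\mathtt{NW},\mathtt W,\mathtt{SW},\mathtt S,\mathtt{SE}$ by $0,1,\ldots,7$ modulo $8$, and let $u_0=(1,0)$, $u_1=(1,1)$, $u_2=(0,1)$, $u_3=(-1,1)$, $u_{i+4}=-u_i$. For an $(r,s)$-leaper $M$, $r\le s$, the initial cycle $D^M_o$ of type $o$ is the cycle of $M$ visiting, in this order, the squares $a_0,a_1,\ldots,a_7$, where $a_i=\alpha u_i$ for $i$ even and $a_i=\beta u_i$ for $i$ odd, with $(\alpha,\beta)=(r+s,r)$ if $o=\mathtt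 f$ (exists provided $r\ne0$), $(\alpha,\beta)=(s-r,s)$ if $o=\mathtt g$ (exists provided $r\ne s$), and $(\alpha,\beta)=(r+s,s)$ if $o=\mathtt h$ (always exists). It is regarded as a concatenation $a_0a_1\ldots a_7$ of eight one-square paths. Matrices. $A_{\mathtt f}=\begin{pmatrix}1&0\\2&1\end{pmatrix}$, $A_{\mathtt g}=\begin{pmatrix}0&1\\-1&2\end{pmatrix}$, $A_{\mathtt h}=A_{\hbar}=\begin{pmatrix}0&1\\1&2\end{pmatrix}$, and $A_{e_1\ldots e_l}=A_{e_1}\cdots A_{e_l}$ (the unit matrix for the empty string). The parameters of $D^M_o$ are $(p,q)$ with $\binom pq=A_o\binom rs$. Lifts. For a path $w$ of squares, $-w$ is $w$ traversed backwards and $w+v$ its translate. Given a cyclic sequence of squares $a_0a_1\ldots a_7$ partitioned into eight paths, with parameters $(p,q)$, its lift of type $t$ is $b_0b_1\ldots b_7$ with parameters $(p',q')$, $\binom{p'}{q'}=A_t\binom pq$, where type $\mathtt f$: $b_i=(-a_{i+5})(-a_{i+4})(-a_{i+3})+(p+q)u_i$ for $i$ even, $b_i=a_i+pu_i$ for $i$ odd; type $\mathtt g$: $b_i=a_i+(q-p)u_i$ for $i$ even, $b_i=(-a_{i+5})(-a_{i+4})(-a_{i+3})+qu_i$ for $i$ odd; type $\mathtt h$: $b_i=(-a_{i+6})(-a_{i+5})(-a_{i+4})(-a_{i+3})(-a_{i+2})+(p+q)u_i$ for $i$ even, $b_i=a_{i-1}a_ia_{i+1}+qu_i$ for $i$ odd;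 type $\hbar$: $b_i=a_{i-1}a_ia_{i+1}+(p+q)u_i$ for $i$ even, $b_i=(-a_{i+6})(-a_{i+5})(-a_{i+4})(-a_{i+3})(-a_{i+2})+qu_i$ for $i$ odd. $D^M_o(e)$ is obtained from $D^M_o$ by successively applying lifts of types $e_l,e_{l-1},\ldots,e_1$; its parameters $(p,q)$ are given by $\binom pq=A_eA_o\binom rs$. $L^M_o(e)$ is the $(p,q)$-leaper with these parameters and $B^M_o(e)$ is the board formed by the squares of $D^M_o(e)$. *)

theory Defs
  imports "HOL-Analysis.Analysis" "Graph_Theory.Graph_Theory"
begin

type_synonym square = "int \<times> int"
type_synonym board = "square set"

text \<open>The \<open>(p,q)\<close>-leaper is represented by the vector \<open>(p,q)\<close>; a leaper therefore has the two
  representations \<open>(p,q)\<close> and \<open>(q,p)\<close>, which \<open>same_leaper\<close> identifies.\<close>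

type_synonym leaper = "int ^ 2"

definition is_leaper :: "leaper \<Rightarrow> bool" where
  "is_leaper L \<longleftrightarrow> L $ 1 \<ge> 0 \<and> L $ 2 \<ge> 0 \<and> L \<noteq> 0"

definition same_leaper :: "leaper \<Rightarrow> leaper \<Rightarrow> bool" where
  "same_leaper L M \<longleftrightarrow> L = M \<or> (L $ 1 = M $ 2 \<and> L $ 2 = M $ 1)"

definition leaper_move :: "leaper \<Rightarrow> square \<Rightarrow> square \<Rightarrow> bool" where
  "leaper_move L a b \<longleftrightarrow> (\<exists>\<sigma> \<in> {1, -1}. \<exists>\<tau> \<in> {1, -1}.
     b = a + (\<sigma> * L $ 1, \<tau> * L $ 2) \<or> b = a + (\<sigma> * L $ 2, \<tau> * L $ 1))"

text \<open>An undirected graph is encoded as a digraph with a symmetric set of arcs.\<close>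

definition leaper_graph :: "leaper \<Rightarrow> board \<Rightarrow> square pair_pre_digraph" where
  "leaper_graph L B =
     \<lparr> pverts = B, parcs = {(a, b). a \<in> B \<and> b \<in> B \<and> leaper_move L a b} \<rparr>"

definition dual :: "board \<Rightarrow> leaper \<Rightarrow> leaper \<Rightarrow> bool" where
  "dual B L M \<longleftrightarrow> is_leaper L \<and> is_leaper M \<and> \<not> same_leaper L M \<and>
     (\<exists>a \<in> B. \<exists>b \<in> B. a \<noteq> b) \<and>
     Digraph_Component.connected (with_proj (leaper_graph L B)) \<and>
     Digraph_Component.connected (with_proj (leaper_graph M B)) \<and>
     digraph_iso (with_proj (leaper_graph L B)) (with_proj (leaper_graph M B))"

text \<open>\<open>Thbar\<close> stands for the fourth character, an \<open>h\<close> with a bar.\<close>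

datatype type_char = Tf | Tg | Th | Thbar

fun A_char :: "type_char \<Rightarrow> int ^ 2 ^ 2" where
  "A_char Tf = vector [vector [1, 0], vector [2, 1]]"
| "A_char Tg = vector [vector [0, 1], vector [-1, 2]]"
| "A_char Th = vector [vector [0, 1], vector [1, 2]]"
| "A_char Thbar = vector [vector [0, 1], vector [1, 2]]"

fun A_string :: "type_char list \<Rightarrow> int ^ 2 ^ 2" where
  "A_string [] = mat 1"
| "A_string (t # e) = A_char t ** A_string e"

text \<open>Indices modulo 8 are arbitrary integers: the directions \<open>udir\<close>, the initial cycles and
  their lifts are functions of period 8, and the parity of an index is well defined modulo 8.\<close>

definition udir :: "int \<Rightarrow> square" where
  "udir i = [(1, 0), (1, 1), (0, 1), (-1, 1), (-1, 0), (-1, -1), (0, -1), (1, -1)] ! nat (i mod 8)"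

definition scale :: "int \<Rightarrow> square \<Rightarrow> square" where
  "scale c v = (c * fst v, c * snd v)"

type_synonym path_cycle = "int \<Rightarrow> square list"

fun initial_exists :: "leaper \<Rightarrow> type_char \<Rightarrow> bool" where
  "initial_exists M Tf \<longleftrightarrow> M $ 1 \<noteq> 0"
| "initial_exists M Tg \<longleftrightarrow> M $ 1 \<noteq> M $ 2"
| "initial_exists M Th \<longleftrightarrow> True"
| "initial_exists M Thbar \<longleftrightarrow> False"

definition octagon :: "int \<Rightarrow> int \<Rightarrow> path_cycle" where
  "octagon \<alpha> \<beta> i = [scale (if even i then \<alpha> else \<beta>) (udir i)]"

text \<open>There is no initial cycle of type \<open>Thbar\<close>, and \<open>initial_cycle M Thbar\<close> is unspecified.\<close>

fun initial_cycle :: "leaper \<Rightarrow> type_char \<Rightarrow> path_cycle" where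
  "initial_cycle M Tf = octagon (M $ 1 + M $ 2) (M $ 1)"
| "initial_cycle M Tg = octagon (M $ 2 - M $ 1) (M $ 2)"
| "initial_cycle M Th = octagon (M $ 1 + M $ 2) (M $ 2)"

definition translate :: "square list \<Rightarrow> square \<Rightarrow> square list" where
  "translate w v = map (\<lambda>x. x + v) w"

text \<open>In each case the whole concatenation is translated.\<close>

fun lift :: "type_char \<Rightarrow> int ^ 2 \<Rightarrow> path_cycle \<Rightarrow> path_cycle" where
  "lift Tf P a i =
     (if even i
      then translate (rev (a (i + 5)) @ rev (a (i + 4)) @ rev (a (i + 3)))
             (scale (P $ 1 + P $ 2) (udir i))
      else translate (a i) (scale (P $ 1) (udir i)))"
| "lift Tg P a i =
     (if even i
      then translate (a i) (scale (P $ 2 - P $ 1) (udir i))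
      else translate (rev (a (i + 5)) @ rev (a (i + 4)) @ rev (a (i + 3)))
             (scale (P $ 2) (udir i)))"
| "lift Th P a i =
     (if even i
      then translate (rev (a (i + 6)) @ rev (a (i + 5)) @ rev (a (i + 4)) @ rev (a (i + 3))
               @ rev (a (i + 2)))
             (scale (P $ 1 + P $ 2) (udir i))
      else translate (a (i - 1) @ a i @ a (i + 1)) (scale (P $ 2) (udir i)))"
| "lift Thbar P a i =
     (if even i
      then translate (a (i - 1) @ a i @ a (i + 1)) (scale (P $ 1 + P $ 2) (udir i))
      else translate (rev (a (i + 6)) @ rev (a (i + 5)) @ rev (a (i + 4)) @ rev (a (i + 3))
               @ rev (a (i + 2)))
             (scale (P $ 2) (udir i)))"

definition parameters :: "leaper \<Rightarrow> type_char \<Rightarrow> type_char list \<Rightarrow> int ^ 2" where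
  "parameters M k e = (A_string e ** A_char k) *v M"

text \<open>The last character of the string is applied first.\<close>

fun lifted_cycle :: "leaper \<Rightarrow> type_char \<Rightarrow> type_char list \<Rightarrow> path_cycle" where
  "lifted_cycle M k [] = initial_cycle M k"
| "lifted_cycle M k (t # e) = lift t (parameters M k e) (lifted_cycle M k e)"

definition lifted_leaper :: "leaper \<Rightarrow> type_char \<Rightarrow> type_char list \<Rightarrow> leaper" where
  "lifted_leaper M k e = parameters M k e"

definition lifted_board :: "leaper \<Rightarrow> type_char \<Rightarrow> type_char list \<Rightarrow> board" where
  "lifted_board M k e = (\<Union>i \<in> {0..<8}. set (lifted_cycle M k e i))"

end

theory Submission
  imports Defs
begin

text \<open>
  Let \<open>(p, q)\<close> be the parameters of a cycle \<open>a\<^sub>0 \<dots> a\<^sub>7\<close> and let \<open>m\<^sub>k\<close> be the move of the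
  \<open>(p, q)\<close>-leaper \<open>L\<close> that lies between the directions \<open>k\<close> and \<open>k + 1\<close>. The proof rests on the
  following identity, which every initial cycle satisfies and every lift preserves:
  translation by \<open>m\<^sub>k\<close> carries \<open>a\<^bsub>k+4\<^esub> a\<^bsub>k+5\<^esub>\<close> to \<open>a\<^sub>k a\<^bsub>k+1\<^esub>\<close> traversed backwards.
  So each square \<open>v\<close> of \<open>a\<^sub>i\<close> has the two \<open>L\<close>-neighbours \<open>v + m\<^bsub>i+3\<^esub>\<close> and \<open>v + m\<^bsub>i+4\<^esub>\<close> on the board.

  If it has no others (\<open>long_neighbours\<close>), the graph of \<open>L\<close> is 2-regular; if it is moreover connected,
  it is a cycle (\<open>two_regular_connected_cyclic\<close>). If the squares of \<open>a\<^sub>0 \<dots> a\<^sub>7\<close> are distinct and \<open>M\<close>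
  joins no two of them but the cyclically consecutive ones, then the graph of \<open>M\<close> is a cycle too
  (\<open>short_cyclic\<close>). Two cycles through the same squares are isomorphic (\<open>cyclic_lists_iso\<close>).

  Connectedness is inherited by a lift: the lifted board consists of translates of the paths
  \<open>a\<^sub>j\<close>, the translates of one square are connected by moves of the new leaper, and a move of \<open>L\<close>
  gives a move of the new leaper between suitable translates of its ends (\<open>b_connected\<close>).

  That no further squares coincide or are joined by a move is the difficult part. It is
  expressed by statements \<open>apart\<close>: the differences of squares of \<open>a\<^sub>j\<close> and \<open>a\<^sub>i\<close>, corrected by at most
  one move of \<open>M\<close> and translated by an integral combination of \<open>p\<close> and \<open>q\<close>, avoid a certain cone.
  The predicate \<open>lift_invariant\<close> collects finitely many such statements up to rotation, together
  with upper bounds on the extent of the paths in the eight directions. A statement about the lift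
  splits into statements about translates of the old paths. Each of them follows from the bounds
  or from an old statement, possibly after the identity above has been used at most twice to
  move one of the two squares to another path. The search for such a derivation is the function \<open>sep\<close>,
  which is proved correct (\<open>apart_sep\<close>) and evaluated by rewriting for the four types of lift
  (\<open>links_lift\<close>, \<open>bounds_lift\<close>, \<open>cones_lift\<close>, \<open>moves_lift\<close>). Only the coefficients
  of \<open>p\<close> and \<open>q\<close> enter, so that one calculation serves for all \<open>0 < p < q\<close>.

  The three initial cycles are one and the same: with \<open>0 < p < q\<close> their parameters, each is the
  octagon with vertices \<open>(q - p) u\<^sub>i\<close> for \<open>i\<close> even and \<open>p u\<^sub>i\<close> for \<open>i\<close> odd, and \<open>M\<close> is the
  \<open>(p, \<bar>q - 2p\<bar>)\<close>-leaper. It remains to verify the invariant for the octagon (\<open>octagon_invariant\<close>).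
\<close>

section \<open>Cycles and induced paths in a graph\<close>

text \<open>The distinct entries of \<open>xs\<close>, in this cyclic order, form an induced cycle of \<open>R\<close>.\<close>
definition cyclic_list :: "('a \<Rightarrow> 'a \<Rightarrow> bool) \<Rightarrow> 'a list \<Rightarrow> bool" where
  "cyclic_list R xs \<longleftrightarrow> distinct xs \<and> (\<forall>i < length xs. \<forall>j < length xs.
     R (xs ! i) (xs ! j) \<longleftrightarrow> j = Suc i mod length xs \<or> i = Suc j mod length xs)"

text \<open>The distinct entries of \<open>xs\<close> form an induced path of \<open>R\<close>: no further pairs are related.\<close>
definition induced_path :: "('a \<Rightarrow> 'a \<Rightarrow> bool) \<Rightarrow> 'a list \<Rightarrow> bool" where
  "induced_path R xs \<longleftrightarrow> distinct xs \<and> (\<forall>i < length xs. \<forall>j < length xs.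
     R (xs ! i) (xs ! j) \<longleftrightarrow> j = Suc i \<or> i = Suc j)"

text \<open>No entry of the one list coincides with or is adjacent to an entry of the other.\<close>
definition separated :: "('a \<Rightarrow> 'a \<Rightarrow> bool) \<Rightarrow> 'a list \<Rightarrow> 'a list \<Rightarrow> bool" where
  "separated R xs ys \<longleftrightarrow> (\<forall>x \<in> set xs. \<forall>y \<in> set ys. x \<noteq> y \<and> \<not> R x y)"

text \<open>As \<open>separated\<close>, except that the end of \<open>xs\<close> is adjacent to the beginning of \<open>ys\<close>.\<close>
definition joined :: "('a \<Rightarrow> 'a \<Rightarrow> bool) \<Rightarrow> 'a list \<Rightarrow> 'a list \<Rightarrow> bool" where
  "joined R xs ys \<longleftrightarrow> (\<forall>x \<in> set xs. \<forall>y \<in> set ys. x \<noteq> y \<and> (R x y \<longleftrightarrow> x = last xs \<and> y = hd ys))"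

text \<open>A longest path closes up: its last vertex has both neighbours on the path, and
  the inner vertices have no room for a third neighbour. By connectedness it then contains all vertices.\<close>
lemma two_regular_connected_cyclic:
  assumes fin: "finite V" and ne: "V \<noteq> {}"
    and sym: "\<And>x y. R x y \<Longrightarrow> R y x"
    and irr: "\<And>x. \<not> R x x"
    and reg: "\<And>x. x \<in> V \<Longrightarrow> card {y \<in> V. R x y} = 2"
    and con: "\<And>x y. x \<in> V \<Longrightarrow> y \<in> V \<Longrightarrow> (x, y) \<in> {(x, y). x \<in> V \<and> y \<in> V \<and> R x y}\<^sup>*"
  obtains xs where "cyclic_list R xs" and "set xs = V"
proof -
  define path where "path xs \<longleftrightarrow> xs \<noteq> [] \<and> distinct xs \<and> set xs \<subseteq> V \<and>
    (\<forall>i. Suc i < length xs \<longrightarrow> R (xs ! i) (xs ! Suc i))" for xs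
  obtain v where "v \<in> V" using ne by blast
  then have "path [v]" by (simp add: path_def)
  moreover have "\<forall>xs. path xs \<longrightarrow> length xs < Suc (card V)"
    by (metis card_mono distinct_card fin path_def le_imp_less_Suc)
  ultimately obtain xs where xs: "path xs" and mx: "\<And>ys. path ys \<Longrightarrow> length ys \<le> length xs"
    using ex_has_greatest_nat[of path "[v]" length "Suc (card V)"] by (metis less_imp_le)
  define n where "n = length xs"
  have dist: "distinct xs" and sub: "set xs \<subseteq> V" and n0: "n > 0"
    and step: "\<And>i. Suc i < n \<Longrightarrow> R (xs ! i) (xs ! Suc i)"
    using xs by (auto simp: path_def n_def)
  have inV: "xs ! i \<in> V" if "i < n" for i using that sub n_def nth_mem by blast
  have eqi: "xs ! i = xs ! j \<longleftrightarrow> i = j" if "i < n" "j < n" for i j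
    using dist that n_def nth_eq_iff_index_eq by blast
  define l where "l = xs ! (n - 1)"
  have lV: "l \<in> V" using inV n0 by (simp add: l_def)
  have nb: "y \<in> set xs" if "y \<in> V" "R l y" for y
  proof (rule ccontr)
    assume y: "y \<notin> set xs"
    have "path (xs @ [y])" unfolding path_def
    proof (intro conjI allI impI)
      show "distinct (xs @ [y])" "set (xs @ [y]) \<subseteq> V" using dist sub y that by auto
      fix i assume i: "Suc i < length (xs @ [y])"
      show "R ((xs @ [y]) ! i) ((xs @ [y]) ! Suc i)"
      proof (cases "Suc i < n")
        case True then show ?thesis using step by (simp add: nth_append n_def)
      next
        case False
        then have "i = n - 1" "n = Suc i" using i n0 by (auto simp: n_def)
        then show ?thesis using that by (auto simp: nth_append n_def l_def)
      qed
    qed simp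
    then show False using mx[of "xs @ [y]"] by simp
  qed
  \<comment> \<open>Both neighbours of the last vertex \<open>l\<close> are on the path, which therefore has at least three vertices.\<close>
  have Nl: "{y \<in> V. R l y} \<subseteq> set xs - {l}" using nb irr by blast
  then have "2 \<le> card (set xs - {l})"
    using reg[OF lV] by (metis List.finite_set card_mono finite_Diff)
  moreover have "l \<in> set xs" using n0 by (simp add: l_def n_def)
  ultimately have n3: "n \<ge> 3" using dist by (simp add: distinct_card n_def card_Diff_singleton)
  have two: "{y \<in> V. R x y} = {u, w}" if "x \<in> V" "u \<in> V" "w \<in> V" "R x u" "R x w" "u \<noteq> w" for x u w
    using card_subset_eq[of "{y \<in> V. R x y}" "{u, w}"] reg[of x] that fin by auto
  \<comment> \<open>The second neighbour of \<open>l\<close> cannot be an inner vertex, as that would get a third neighbour.\<close>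
  have close: "R l (xs ! 0)"
  proof -
    have s: "R l (xs ! (n - 2))"
      using step[of "n - 2"] n3 sym by (auto simp: l_def Suc_diff_le numeral_2_eq_2 Suc_diff_Suc)
    have "{y \<in> V. R l y} \<noteq> {xs ! (n - 2)}" using reg[OF lV] by auto
    then obtain y where y: "y \<in> V" "R l y" "y \<noteq> xs ! (n - 2)"
      using s inV[of "n - 2"] n3 by auto
    obtain i where i: "i < n" "y = xs ! i" using nb[OF y(1,2)] unfolding in_set_conv_nth n_def by blast
    have i': "i \<noteq> n - 1" "i \<noteq> n - 2" using y i irr by (auto simp: l_def)
    have "i = 0"
    proof (rule ccontr)
      assume "i \<noteq> 0"
      then obtain h where h: "i = Suc h" by (cases i) auto
      have hs: "Suc i < n" using i i' by linarith
      have "{y \<in> V. R (xs ! i) y} = {xs ! h, xs ! Suc i}"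
        using two[of "xs ! i" "xs ! h" "xs ! Suc i"] inV step[of h] step[of i] sym h hs eqi[of h "Suc i"] i
        by auto
      moreover have "l \<in> {y \<in> V. R (xs ! i) y}" using lV sym y i by auto
      ultimately have "n - 1 = h \<or> n - 1 = Suc i" using eqi n0 h hs i by (auto simp: l_def)
      then show False using h hs i' i by auto
    qed
    then show ?thesis using y i by simp
  qed
  have next_in: "Suc i mod n < n" for i using n0 by simp
  have nxt: "R (xs ! i) (xs ! (Suc i mod n))" if "i < n" for i
  proof (cases "Suc i < n")
    case True then show ?thesis using step by simp
  next
    case False then have "Suc i = n" using that by simp
    then show ?thesis using close by (auto simp: l_def)
  qed
  have nbs: "{y \<in> V. R (xs ! i) y} = {xs ! (Suc i mod n), xs ! h}"
    if "i < n" "h < n" "Suc h mod n = i" for i h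
  proof -
    have "Suc i mod n \<noteq> h"
    proof
      assume e: "Suc i mod n = h"
      show False
      proof (cases "Suc i < n")
        case True then show False using e that n3 by (cases "Suc h < n") (auto simp: mod_Suc split: if_splits)
      next
        case False then show False using e that n3 by (auto simp: mod_Suc split: if_splits)
      qed
    qed
    then have "xs ! (Suc i mod n) \<noteq> xs ! h" using eqi[OF next_in that(2)] by simp
    moreover have "R (xs ! i) (xs ! h)" using sym[OF nxt[OF that(2)]] that(3) by simp
    ultimately show ?thesis
      using two[OF inV[OF that(1)] inV[OF next_in] inV[OF that(2)] nxt[OF that(1)]] by simp
  qed
  have prev: "\<exists>h < n. Suc h mod n = i" if "i < n" for i
  proof (cases i)
    case 0 then show ?thesis using n0 by (intro exI[of _ "n - 1"]) auto
  next
    case (Suc h) then show ?thesis using that by (intro exI[of _ h]) auto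
  qed
  have closed: "y \<in> set xs" if x: "x \<in> set xs" and "y \<in> V" "R x y" for x y
  proof -
    obtain i where i: "i < n" "x = xs ! i" using x unfolding in_set_conv_nth n_def by blast
    obtain h where h: "h < n" "Suc h mod n = i" using prev[OF i(1)] by blast
    have "y \<in> {y \<in> V. R (xs ! i) y}" using that i by simp
    then have "y = xs ! (Suc i mod n) \<or> y = xs ! h" unfolding nbs[OF i(1) h] by simp
    then show ?thesis using nth_mem[of h xs] nth_mem[of "Suc i mod n" xs] h next_in[of i]
      unfolding n_def by metis
  qed
  have V: "set xs = V"
  proof (intro equalityI sub subsetI)
    fix y assume "y \<in> V"
    then have "(l, y) \<in> {(x, y). x \<in> V \<and> y \<in> V \<and> R x y}\<^sup>*" using con lV by blast
    then show "y \<in> set xs"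
      by (induction rule: rtrancl_induct) (use \<open>l \<in> set xs\<close> closed in auto)
  qed
  have "cyclic_list R xs" unfolding cyclic_list_def
  proof (intro conjI allI impI dist)
    fix i j assume ij: "i < length xs" "j < length xs"
    obtain h where h: "h < n" "Suc h mod n = i" using prev[of i] ij unfolding n_def by blast
    have "R (xs ! i) (xs ! j) \<longleftrightarrow> xs ! j \<in> {y \<in> V. R (xs ! i) y}"
      using inV[of j] ij by (simp add: n_def)
    also have "\<dots> \<longleftrightarrow> xs ! j = xs ! (Suc i mod n) \<or> xs ! j = xs ! h"
      using nbs[OF _ h] ij by (simp add: n_def)
    also have "\<dots> \<longleftrightarrow> j = Suc i mod n \<or> j = h"
      using eqi[of j "Suc i mod n"] eqi[of j h] next_in[of i] h ij by (simp add: n_def)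
    also have "j = h \<longleftrightarrow> i = Suc j mod n"
    proof
      assume "i = Suc j mod n"
      then have "Suc j mod n = Suc h mod n" using h by simp
      then show "j = h" using h ij n3 by (auto simp: n_def mod_Suc split: if_splits)
    qed (use h in auto)
    finally show "R (xs ! i) (xs ! j) \<longleftrightarrow> j = Suc i mod length xs \<or> i = Suc j mod length xs"
      by (simp add: n_def)
  qed
  then show thesis using V that by blast
qed

lemma induced_path_append:
  assumes sym: "\<And>x y. R x y \<longleftrightarrow> R y x" and xs: "induced_path R xs" "xs \<noteq> []"
    and ys: "induced_path R ys" "ys \<noteq> []" and j: "joined R xs ys"
  shows "induced_path R (xs @ ys)"
proof -
  define m where "m = length xs"
  have cross: "R (xs ! i) (ys ! j) \<longleftrightarrow> Suc i = m \<and> j = 0" if "i < m" "j < length ys" for i j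
  proof -
    have "R (xs ! i) (ys ! j) \<longleftrightarrow> xs ! i = xs ! (m - 1) \<and> ys ! j = ys ! 0"
      using j that xs(2) ys(2) by (auto simp: joined_def m_def last_conv_nth hd_conv_nth)
    also have "\<dots> \<longleftrightarrow> i = m - 1 \<and> j = 0"
      using xs ys that by (auto simp: induced_path_def m_def nth_eq_iff_index_eq)
    finally show ?thesis using that by auto
  qed
  have "set xs \<inter> set ys = {}" using j by (auto simp: joined_def)
  then have "distinct (xs @ ys)" using xs ys by (auto simp: induced_path_def)
  moreover have "R ((xs @ ys) ! i) ((xs @ ys) ! j) \<longleftrightarrow> j = Suc i \<or> i = Suc j"
    if "i < length (xs @ ys)" "j < length (xs @ ys)" for i j
  proof -
    consider "i < m" "j < m" | "i < m" "j \<ge> m" | "i \<ge> m" "j < m" | "i \<ge> m" "j \<ge> m" by linarith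
    then show ?thesis
    proof cases
      case 1 then show ?thesis using xs by (auto simp: nth_append induced_path_def m_def)
    next
      case 2
      then have "R ((xs @ ys) ! i) ((xs @ ys) ! j) \<longleftrightarrow> Suc i = m \<and> j - m = 0"
        using cross[of i "j - m"] that by (auto simp: nth_append m_def)
      then show ?thesis using 2 by auto
    next
      case 3
      then have "R ((xs @ ys) ! j) ((xs @ ys) ! i) \<longleftrightarrow> Suc j = m \<and> i - m = 0"
        using cross[of j "i - m"] that by (auto simp: nth_append m_def)
      then have "R ((xs @ ys) ! i) ((xs @ ys) ! j) \<longleftrightarrow> Suc j = m \<and> i - m = 0"
        by (subst sym)
      then show ?thesis using 3 by auto
    next
      case 4
      then have "R ((xs @ ys) ! i) ((xs @ ys) ! j) \<longleftrightarrow> j - m = Suc (i - m) \<or> i - m = Suc (j - m)"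
        using ys that by (auto simp: nth_append induced_path_def m_def)
      then show ?thesis using 4 by auto
    qed
  qed
  ultimately show ?thesis by (simp add: induced_path_def)
qed

lemma cyclic_list_append:
  assumes sym: "\<And>x y. R x y \<longleftrightarrow> R y x" and xs: "induced_path R xs" "xs \<noteq> []"
    and ys: "induced_path R ys" "ys \<noteq> []" and len: "length xs + length ys \<ge> 3"
    and j: "\<And>x y. x \<in> set xs \<Longrightarrow> y \<in> set ys \<Longrightarrow>
      x \<noteq> y \<and> (R x y \<longleftrightarrow> x = last xs \<and> y = hd ys \<or> x = hd xs \<and> y = last ys)"
  shows "cyclic_list R (xs @ ys)"
proof -
  define m n where "m = length xs" and "n = length (xs @ ys)"
  have mn: "0 < m" "m < n" "3 \<le> n" using xs ys len by (auto simp: m_def n_def)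
  have cross: "R (xs ! i) (ys ! (j - m)) \<longleftrightarrow> Suc i = m \<and> j = m \<or> i = 0 \<and> Suc j = n"
    if "i < m" "j < n" "m \<le> j" for i j
  proof -
    have "R (xs ! i) (ys ! (j - m)) \<longleftrightarrow> xs ! i = xs ! (m - 1) \<and> ys ! (j - m) = ys ! 0
        \<or> xs ! i = xs ! 0 \<and> ys ! (j - m) = ys ! (n - m - 1)"
      using j[of "xs ! i" "ys ! (j - m)"] that xs(2) ys(2)
      by (auto simp: m_def n_def last_conv_nth hd_conv_nth)
    also have "\<dots> \<longleftrightarrow> i = m - 1 \<and> j - m = 0 \<or> i = 0 \<and> j - m = n - m - 1"
    proof -
      have "xs ! i = xs ! i' \<longleftrightarrow> i = i'" if "i' < m" for i'
        using xs that \<open>i < m\<close> by (auto simp: induced_path_def m_def nth_eq_iff_index_eq)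
      moreover have "ys ! (j - m) = ys ! j' \<longleftrightarrow> j - m = j'" if "j' < n - m" for j'
        using ys that \<open>j < n\<close> \<open>m \<le> j\<close> by (auto simp: induced_path_def m_def n_def nth_eq_iff_index_eq)
      ultimately show ?thesis using mn by auto
    qed
    finally show ?thesis using that mn by auto
  qed
  have "set xs \<inter> set ys = {}" using j by blast
  then have "distinct (xs @ ys)" using xs ys by (auto simp: induced_path_def)
  moreover have "R ((xs @ ys) ! i) ((xs @ ys) ! j) \<longleftrightarrow> j = Suc i mod n \<or> i = Suc j mod n"
    if ij: "i < n" "j < n" for i j
  proof -
    have S: "Suc i mod n = (if Suc i = n then 0 else Suc i)" "Suc j mod n = (if Suc j = n then 0 else Suc j)"
      using ij by auto
    consider "i < m" "j < m" | "i < m" "j \<ge> m" | "i \<ge> m" "j < m" | "i \<ge> m" "j \<ge> m" by linarith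
    then show ?thesis
    proof cases
      case 1 then show ?thesis using xs mn unfolding S by (auto simp: nth_append induced_path_def m_def)
    next
      case 2
      then have "R ((xs @ ys) ! i) ((xs @ ys) ! j) \<longleftrightarrow> Suc i = m \<and> j = m \<or> i = 0 \<and> Suc j = n"
        using cross[of i j] that by (auto simp: nth_append m_def)
      then show ?thesis using 2 mn unfolding S by auto
    next
      case 3
      then have "R ((xs @ ys) ! j) ((xs @ ys) ! i) \<longleftrightarrow> Suc j = m \<and> i = m \<or> j = 0 \<and> Suc i = n"
        using cross[of j i] that by (auto simp: nth_append m_def)
      then have "R ((xs @ ys) ! i) ((xs @ ys) ! j) \<longleftrightarrow> Suc j = m \<and> i = m \<or> j = 0 \<and> Suc i = n"
        by (subst sym)
      then show ?thesis using 3 mn unfolding S by auto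
    next
      case 4
      then have "R ((xs @ ys) ! i) ((xs @ ys) ! j) \<longleftrightarrow> j - m = Suc (i - m) \<or> i - m = Suc (j - m)"
        using ys that by (auto simp: nth_append induced_path_def m_def n_def)
      then show ?thesis using 4 mn ij unfolding S by auto
    qed
  qed
  ultimately show ?thesis by (simp add: cyclic_list_def n_def)
qed

lemma induced_path_rev: "induced_path R (rev xs) \<longleftrightarrow> induced_path R xs"
proof -
  have "induced_path R (rev xs)" if "induced_path R xs" for xs
    unfolding induced_path_def
  proof (intro conjI allI impI)
    show "distinct (rev xs)" using that by (simp add: induced_path_def)
    fix i j assume "i < length (rev xs)" "j < length (rev xs)"
    then have ij: "i < length xs" "j < length xs" by simp_all
    have "R (rev xs ! i) (rev xs ! j) \<longleftrightarrow> length xs - Suc j = Suc (length xs - Suc i) \<or>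
        length xs - Suc i = Suc (length xs - Suc j)"
      using that ij by (simp add: rev_nth induced_path_def)
    then show "R (rev xs ! i) (rev xs ! j) \<longleftrightarrow> j = Suc i \<or> i = Suc j" using ij by auto
  qed
  then show ?thesis by (metis rev_rev_ident)
qed

lemma induced_path_map:
  assumes "inj f" "\<And>x y. R (f x) (f y) \<longleftrightarrow> R x y"
  shows "induced_path R (map f xs) \<longleftrightarrow> induced_path R xs"
  using assms by (auto simp: induced_path_def distinct_map inj_on_def)

lemma joined_map:
  assumes "inj f" "\<And>x y. R (f x) (f y) \<longleftrightarrow> R x y" "xs \<noteq> []" "ys \<noteq> []"
  shows "joined R (map f xs) (map f ys) \<longleftrightarrow> joined R xs ys"
  using assms by (auto simp: joined_def last_map hd_map inj_eq)

lemma joined_append: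
  assumes j: "joined R xs ys" and ne: "xs \<noteq> []" "ys \<noteq> []"
    and us: "separated R us (ys @ vs)" and vs: "separated R xs vs"
  shows "joined R (us @ xs) (ys @ vs)"
proof -
  have hl: "hd (ys @ vs) = hd ys" "last (us @ xs) = last xs" "hd ys \<in> set ys" "last xs \<in> set xs"
    using ne by simp_all
  have R: "R (last xs) (hd ys)" using j hl by (simp add: joined_def)
  have u: "u \<noteq> last xs" if "u \<in> set us" for u
    using us that R hl by (auto simp: separated_def)
  have v: "v \<noteq> hd ys" if "v \<in> set vs" for v
    using vs that R hl by (auto simp: separated_def)
  show ?thesis unfolding joined_def hl(1,2)
  proof (intro ballI)
    fix x y assume "x \<in> set (us @ xs)" "y \<in> set (ys @ vs)"
    then consider "x \<in> set us" "y \<in> set (ys @ vs)" | "x \<in> set xs" "y \<in> set vs"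
      | "x \<in> set xs" "y \<in> set ys" by auto
    then show "x \<noteq> y \<and> (R x y \<longleftrightarrow> x = last xs \<and> y = hd ys)"
    proof cases
      case 1 then show ?thesis using us u by (auto simp: separated_def)
    next
      case 2 then show ?thesis using vs v by (auto simp: separated_def)
    next
      case 3 then show ?thesis using j by (auto simp: joined_def)
    qed
  qed
qed

section \<open>Directions and linear forms\<close>

text \<open>A form \<open>(x, y)\<close> stands for the vector \<open>p x + q y\<close> depending on the parameters \<open>p\<close> and \<open>q\<close>.\<close>
type_synonym form = "square \<times> square"

definition value_of :: "int \<Rightarrow> int \<Rightarrow> form \<Rightarrow> square" where
  "value_of p q f = scale p (fst f) + scale q (snd f)"

text \<open>The inner product with the direction \<open>u\<^sub>k\<close>.\<close>
definition dot :: "int \<Rightarrow> square \<Rightarrow> int" where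
  "dot k v = fst (udir k) * fst v + snd (udir k) * snd v"

text \<open>The coefficients of \<open>p\<close> and \<open>q\<close> in the inner product of \<open>u\<^sub>k\<close> with the vector of a form.\<close>
definition form_dot :: "int \<Rightarrow> form \<Rightarrow> square" where
  "form_dot k f = (dot k (fst f), dot k (snd f))"

text \<open>The multiple of \<open>u\<^sub>k\<close> by \<open>c\<^sub>1 p + c\<^sub>2 q\<close>, as a form.\<close>
definition along :: "square \<Rightarrow> int \<Rightarrow> form" where
  "along c k = (scale (fst c) (udir k), scale (snd c) (udir k))"

text \<open>The move of the \<open>(p, q)\<close>-leaper between the directions \<open>k\<close> and \<open>k + 1\<close> (for \<open>0 < p < q\<close>), as a form:
  \<open>(q, p)\<close>, \<open>(p, q)\<close>, \<open>(-p, q)\<close>, and so on counterclockwise.\<close>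
definition mv :: "int \<Rightarrow> form" where
  "mv k = [((0, 1), (1, 0)), ((1, 0), (0, 1)), ((-1, 0), (0, 1)), ((0, 1), (-1, 0)),
     ((0, -1), (-1, 0)), ((-1, 0), (0, -1)), ((1, 0), (0, -1)), ((0, -1), (1, 0))] ! nat (k mod 8)"

text \<open>The rotation by a right angle, which adds 2 to the number of a direction.\<close>
definition rot :: "square \<Rightarrow> square" where
  "rot v = (- snd v, fst v)"

definition rotf :: "form \<Rightarrow> form" where
  "rotf f = (rot (fst f), rot (snd f))"

lemma mod8_cases:
  fixes k :: int
  obtains "k mod 8 = 0" | "k mod 8 = 1" | "k mod 8 = 2" | "k mod 8 = 3"
    | "k mod 8 = 4" | "k mod 8 = 5" | "k mod 8 = 6" | "k mod 8 = 7"
proof -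
  have "k mod 8 = 0 \<or> k mod 8 = 1 \<or> k mod 8 = 2 \<or> k mod 8 = 3 \<or> k mod 8 = 4 \<or> k mod 8 = 5
    \<or> k mod 8 = 6 \<or> k mod 8 = 7" by presburger
  then show ?thesis using that by (elim disjE)
qed

lemma mod_add_cases:
  fixes k :: int
  shows "(k + 1) mod 8 = (k mod 8 + 1) mod 8" "(k + 2) mod 8 = (k mod 8 + 2) mod 8"
    "(k + 3) mod 8 = (k mod 8 + 3) mod 8" "(k + 4) mod 8 = (k mod 8 + 4) mod 8"
  by (simp_all add: mod_add_left_eq)

lemma udir_mod [simp]: "udir (k mod 8) = udir k" by (simp add: udir_def)
lemma mv_mod [simp]: "mv (k mod 8) = mv k" by (simp add: mv_def)

lemma udir_rot: "udir (k + 2) = rot (udir k)"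
  unfolding udir_def mod_add_cases[of k] by (cases k rule: mod8_cases) (simp_all add: rot_def)

lemma mv_rot: "mv (k + 2) = rotf (mv k)"
  unfolding mv_def mod_add_cases[of k] by (cases k rule: mod8_cases) (simp_all add: rot_def rotf_def)

lemma mv_opposite: "mv (k + 4) = - mv k"
  unfolding mv_def mod_add_cases[of k] by (cases k rule: mod8_cases) (simp_all add: uminus_prod_def zero_prod_def)

lemma udir_opposite: "udir (k + 4) = - udir k"
  unfolding udir_def mod_add_cases[of k] by (cases k rule: mod8_cases) (simp_all add: uminus_prod_def)

lemma dot_opposite: "dot (k + 4) v = - dot k v"
  by (simp add: dot_def udir_opposite)

lemma dot_rot: "dot (k + 2) (rot v) = dot k v"
  unfolding dot_def udir_rot by (simp add: rot_def)

lemma dot_mod [simp]: "dot (k mod 8) v = dot k v" by (simp add: dot_def)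

lemma dot_cong: "(k - l) mod 8 = 0 \<Longrightarrow> dot k v = dot l v"
  using dot_mod[of k v] dot_mod[of l v] by (metis mod_eq_dvd_iff dvd_eq_mod_eq_0)

lemma dot_add: "dot k (v + w) = dot k v + dot k w"
  and dot_diff: "dot k (v - w) = dot k v - dot k w"
  and dot_minus: "dot k (- v) = - dot k v"
  and dot_scale: "dot k (scale c v) = c * dot k v"
  by (simp_all add: dot_def scale_def algebra_simps)

lemma dot_value_of: "dot k (value_of p q f) = p * fst (form_dot k f) + q * snd (form_dot k f)"
  by (simp add: value_of_def form_dot_def dot_add dot_scale)

lemma value_of_add: "value_of p q (f + g) = value_of p q f + value_of p q g"
  and value_of_diff: "value_of p q (f - g) = value_of p q f - value_of p q g"
  and value_of_minus: "value_of p q (- f) = - value_of p q f"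
  and value_of_0: "value_of p q 0 = 0"
  by (simp_all add: value_of_def scale_def prod_eq_iff algebra_simps)

lemma rot_add: "rot (v + w) = rot v + rot w"
  and rot_diff: "rot (v - w) = rot v - rot w"
  and rot_rot: "rot (rot v) = - v"
  and rot_scale: "rot (scale c v) = scale c (rot v)"
  and rot_0: "rot 0 = 0"
  by (simp_all add: rot_def scale_def prod_eq_iff)

lemma rot_eq_iff: "rot v = rot w \<longleftrightarrow> v = w"
  by (auto simp: rot_def prod_eq_iff)

lemma value_of_rotf: "value_of p q (rotf f) = rot (value_of p q f)"
  by (simp add: value_of_def rotf_def rot_add rot_scale)

lemma along_rot: "along c (k + 2) = rotf (along c k)"
  by (simp add: along_def rotf_def udir_rot rot_scale)

text \<open>By rotation symmetry, a property of the index needs to be verified for the indices 0 and 1 only.\<close>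
lemma parity_extend:
  fixes P :: "int \<Rightarrow> bool"
  assumes step: "\<And>i. P (i + 2) \<longleftrightarrow> P i" and "P 0" "P 1"
  shows "P i"
proof -
  have "P (j + 2 * int n) \<longleftrightarrow> P j" for j n
  proof (induction n)
    case (Suc n) then show ?case using step[of "j + 2 * int n"] by (simp add: algebra_simps)
  qed simp
  from this[of "i mod 2" "nat (i div 2)"] this[of i "nat (- (i div 2))"]
  have "P i \<longleftrightarrow> P (i mod 2)"
    by (cases "i div 2 \<ge> 0") (simp_all add: minus_mult_div_eq_mod)
  then show ?thesis using assms(2,3) by (cases "even i") (simp_all add: even_iff_mod_2_eq_zero odd_iff_mod_2_eq_one)
qed

section \<open>Separation statements\<close>

text \<open>Lists of directions stand for the dual cones \<open>{x. \<forall>l \<in> set L. 0 \<le> dot l x}\<close>. The one of \<open>wedge g\<close> lies between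
  the directions \<open>g\<close> and \<open>g + 1\<close>, that of \<open>ray g\<close> is the half-line in direction \<open>g\<close>, and that of \<open>all_dirs\<close> is 0.\<close>
definition wedge :: "int \<Rightarrow> int list" where "wedge g = [g - 1, g, g + 1, g + 2]"
definition ray :: "int \<Rightarrow> int list" where "ray g = [g - 2, g - 1, g, g + 1, g + 2]"
definition all_dirs :: "int list" where "all_dirs = [0, 1, 2, 3, 4, 5, 6, 7]"

text \<open>The cones that squares of \<open>a (i + d)\<close>, seen from squares of \<open>a i\<close>, have to avoid: a pair consists of the
  apex and the directions of \<open>apart\<close> below. The cases \<open>d = 5\<close> and \<open>d = 6\<close> follow by exchanging the two paths.
  This table and the next one are chosen so that they reproduce themselves under the four types of lift.\<close>
definition cones :: "int \<Rightarrow> int \<Rightarrow> (form \<times> int list) list" where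
  "cones i d =
    (if d = 2 then
       (let c = (if even i then (-2, 2) else (2, 0)) in
       [(0, ray (i - 1)), (along c (i - 2), wedge (i - 2)), (along c i, wedge (i - 1))])
     else if d = 3 then [(0, wedge (i - 1))]
     else if d = 4 then [(0, ray i)] else [])"

text \<open>Upper bounds \<open>f\<^sub>1 p + f\<^sub>2 q\<close>, all of them valid, for twice the extent of \<open>a i\<close> in direction \<open>k\<close>.
  Doubling makes room for enlarging a path by half a move of the short leaper \<open>M\<close>, so that adding the bounds
  for two paths accounts for one whole move.\<close>
definition bounds :: "int \<Rightarrow> int \<Rightarrow> square list" where
  "bounds i k = (if even i
     then [[(-1, 3)], [(-2, 4), (1, 3)], [(1, 1), (-1, 2)], [(1, 1)], [(0, 1)],
       [(1, 1)], [(1, 1), (-1, 2)], [(-2, 4), (1, 3)]]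
     else [[(4, 2)], [(3, 1), (1, 2)], [(0, 2), (3, 1)], [(0, 1)], [(1, 1)],
       [(0, 1)], [(0, 2), (3, 1)], [(3, 1), (1, 2)]]) ! nat ((k - i) mod 8)"

text \<open>The pairs \<open>(i - k, j - k)\<close>, modulo 8, for which a square of \<open>a i\<close> translated by \<open>m\<^sub>k\<close> may coincide with or
  be adjacent to a square of \<open>a j\<close>.\<close>
definition linked_pairs :: "(int \<times> int) list" where
  "linked_pairs = [(4,0), (4,1), (4,2), (5,7), (5,0), (5,1), (6,0), (3,1)]"

lemma bounds_cong:
  "(k' - i') mod 8 = (k - i) mod 8 \<Longrightarrow> even i' = even i \<Longrightarrow> bounds i' k' = bounds i k"
  by (simp only: bounds_def)

lemma bounds_shift: "bounds i (k + 8) = bounds i k" "bounds (i + 8) k = bounds i k"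
  "bounds (i + 2) (k + 2) = bounds i k"
proof -
  have a: "k + 8 - i = k - i + 8" and b: "k - i = k - (i + 8) + 8" and c: "k + 2 - (i + 2) = k - i"
    by linarith+
  show "bounds i (k + 8) = bounds i k" by (rule bounds_cong) (simp_all only: a mod_add_self2)
  show "bounds (i + 8) k = bounds i k" by (rule bounds_cong) (simp_all only: b mod_add_self2, simp)
  show "bounds (i + 2) (k + 2) = bounds i k" by (rule bounds_cong) (simp_all only: c, simp)
qed

text \<open>The moves \<open>Mv\<close> of the leaper \<open>M\<close>; for the lifts it matters only that they are
  symmetric under quarter turns and different from 0.\<close>
locale move_set =
  fixes Mv :: "square set"
  assumes rot_move: "\<mu> \<in> Mv \<Longrightarrow> rot \<mu> \<in> Mv"
    and zero_move: "0 \<notin> Mv"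
begin

text \<open>At most one move: \<open>w - v \<in> near\<close> when \<open>v\<close> and \<open>w\<close> are equal or adjacent.\<close>
definition near :: "square set" where "near = insert 0 Mv"

definition adj :: "square \<Rightarrow> square \<Rightarrow> bool" where "adj v w \<longleftrightarrow> w - v \<in> Mv"

lemma minus_move: "\<mu> \<in> Mv \<Longrightarrow> - \<mu> \<in> Mv"
  using rot_move[OF rot_move] by (simp add: rot_rot)

lemma adj_sym: "adj v w \<longleftrightarrow> adj w v"
  using minus_move[of "w - v"] minus_move[of "v - w"] by (auto simp: adj_def)

lemma adj_translate: "adj (v + s) (w + s) \<longleftrightarrow> adj v w" by (simp add: adj_def)

lemma rot_move_iff: "rot \<mu> \<in> Mv \<longleftrightarrow> \<mu> \<in> Mv"
proof
  assume "rot \<mu> \<in> Mv"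
  then have "- rot (rot \<mu>) \<in> Mv" using rot_move minus_move by blast
  then show "\<mu> \<in> Mv" by (simp add: rot_rot)
qed (rule rot_move)

lemma adj_rot: "adj (rot v) (rot w) \<longleftrightarrow> adj v w"
  by (simp add: adj_def rot_move_iff flip: rot_diff)

lemma near_rot: "rot \<mu> \<in> near \<longleftrightarrow> \<mu> \<in> near"
  using rot_move_iff rot_eq_iff[of \<mu> 0] by (simp add: near_def rot_0)

lemma near_minus: "- \<mu> \<in> near \<longleftrightarrow> \<mu> \<in> near"
  using near_rot[of "rot \<mu>"] near_rot[of \<mu>] by (simp add: rot_rot)

lemma near_iff: "w - v \<in> near \<longleftrightarrow> v = w \<or> adj v w"
  by (auto simp: near_def adj_def)

text \<open>For \<open>v\<close> in \<open>a i\<close> and \<open>w\<close> in \<open>a j\<close>, neither \<open>w - v\<close> nor its sum with a move of \<open>M\<close> lies in the cone with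
  apex \<open>d\<close> that is dual to the directions \<open>L\<close>. For \<open>L = all_dirs\<close> this says that \<open>w\<close> is neither equal nor
  adjacent to \<open>v + d\<close>.\<close>
definition apart :: "path_cycle \<Rightarrow> int \<Rightarrow> int \<Rightarrow> int \<Rightarrow> int \<Rightarrow> form \<Rightarrow> int list \<Rightarrow> bool" where
  "apart a p q i j d L \<longleftrightarrow> (\<forall>v \<in> set (a i). \<forall>w \<in> set (a j). \<forall>\<mu> \<in> near.
     \<exists>l \<in> set L. dot l (w - v - \<mu> - value_of p q d) < 0)"

text \<open>The invariant of the lifts, in this order: rotation symmetry, the translation identity, the bounds,
  the avoided cones, the absence of accidental moves of \<open>L\<close> up to a move of \<open>M\<close>, and the description of the
  moves of \<open>M\<close> along \<open>a\<close>. In the last but one clause, \<open>a\<^bsub>k+4\<^esub>\<close> and \<open>a\<^bsub>k+5\<^esub>\<close> are the paths that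
  \<open>m\<^sub>k\<close> carries to \<open>a\<^sub>k\<close> and \<open>a\<^bsub>k+1\<^esub>\<close>.\<close>
definition lift_invariant :: "path_cycle \<Rightarrow> int \<Rightarrow> int \<Rightarrow> bool" where
  "lift_invariant a p q \<longleftrightarrow> 0 < p \<and> p < q
     \<and> (\<forall>i. a i \<noteq> [] \<and> a (i + 2) = map rot (a i))
     \<and> (\<forall>k. map (\<lambda>v. v + value_of p q (mv k)) (a (k + 4) @ a (k + 5)) = rev (a k @ a (k + 1)))
     \<and> (\<forall>i k. \<forall>v \<in> set (a i). \<forall>\<mu> \<in> near. \<forall>f \<in> set (bounds i k).
         2 * dot k v + dot k \<mu> < fst f * p + snd f * q)
     \<and> (\<forall>i. \<forall>d. \<forall>c \<in> set (cones i d). apart a p q i (i + d) (fst c) (snd c))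
     \<and> (\<forall>k i j. (i - k) mod 8 \<notin> {4, 5} \<longrightarrow> (j - k) mod 8 \<notin> {0, 1} \<longrightarrow> apart a p q i j (mv k) all_dirs)
     \<and> (\<forall>i. induced_path adj (a i) \<and> joined adj (a i) (a (i + 1)))"

lemma near_all_rot: "(\<forall>\<mu> \<in> near. P \<mu>) \<longleftrightarrow> (\<forall>\<mu> \<in> near. P (rot \<mu>))"
proof
  assume R: "\<forall>\<mu> \<in> near. P (rot \<mu>)"
  show "\<forall>\<mu> \<in> near. P \<mu>"
  proof
    fix \<mu> assume "\<mu> \<in> near"
    then have "rot (rot (rot \<mu>)) \<in> near" by (simp add: near_rot)
    then have "P (rot (rot (rot (rot \<mu>))))" using R by blast
    then show "P \<mu>" by (simp add: rot_rot)
  qed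
qed (simp add: near_rot)

lemma apart_rot:
  assumes "\<And>i. a (i + 2) = map rot (a i)"
  shows "apart a p q (i + 2) (j + 2) (rotf d) (map (\<lambda>l. l + 2) L) \<longleftrightarrow> apart a p q i j d L"
proof -
  have *: "(\<forall>\<mu> \<in> near. \<exists>l \<in> (\<lambda>l. l + 2) ` set L. dot l (rot w - rot v - \<mu> - rot x) < 0) \<longleftrightarrow>
    (\<forall>\<mu> \<in> near. \<exists>l \<in> set L. dot l (w - v - \<mu> - x) < 0)" for v w x
    by (subst near_all_rot) (simp only: rot_diff[symmetric] bex_simps(7) dot_rot)
  show ?thesis
    by (simp only: apart_def assms value_of_rotf list.set_map ball_simps(9) *)
qed

lemma apart_point:
  assumes "apart a p q i j d all_dirs" "v \<in> set (a i)" "w \<in> set (a j)"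
  shows "w - v - value_of p q d \<notin> near"
proof
  assume "w - v - value_of p q d \<in> near"
  then obtain l where "dot l (w - v - (w - v - value_of p q d) - value_of p q d) < 0"
    using assms unfolding apart_def by blast
  then show False by (simp add: dot_def)
qed

lemma dot_all_dirs:
  assumes "v \<noteq> 0" shows "\<exists>l \<in> set all_dirs. dot l v < 0"
proof (rule ccontr)
  assume "\<not> ?thesis"
  then have "dot 0 v \<ge> 0" "dot 2 v \<ge> 0" "dot 4 v \<ge> 0" "dot 6 v \<ge> 0"
    by (auto simp: all_dirs_def not_less)
  then show False using assms by (simp add: dot_def udir_def prod_eq_iff)
qed

lemma apart_pointI:
  assumes "\<And>v w. v \<in> set (a i) \<Longrightarrow> w \<in> set (a j) \<Longrightarrow> w - v - value_of p q d \<notin> near"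
  shows "apart a p q i j d all_dirs"
  unfolding apart_def
proof (intro ballI)
  fix v w \<mu> assume "v \<in> set (a i)" "w \<in> set (a j)" "\<mu> \<in> near"
  moreover have "w - v - value_of p q d = \<mu> + (w - v - \<mu> - value_of p q d)" by simp
  ultimately have "w - v - \<mu> - value_of p q d \<noteq> 0" using assms[of v w] by fastforce
  then show "\<exists>l \<in> set all_dirs. dot l (w - v - \<mu> - value_of p q d) < 0" by (rule dot_all_dirs)
qed

lemma apart_swap:
  assumes "apart a p q j i d L"
  shows "apart a p q i j (- d) (map (\<lambda>l. l + 4) L)"
  unfolding apart_def
proof (intro ballI)
  fix v w \<mu> assume "v \<in> set (a i)" "w \<in> set (a j)" "\<mu> \<in> near"
  moreover from this(3) have "- \<mu> \<in> near" by (simp add: near_minus)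
  ultimately obtain l where l: "l \<in> set L" "dot l (v - w - (- \<mu>) - value_of p q d) < 0"
    using assms unfolding apart_def by blast
  have "v - w - (- \<mu>) - value_of p q d = - (w - v - \<mu> - value_of p q (- d))"
    by (simp add: value_of_minus)
  then have "dot (l + 4) (w - v - \<mu> - value_of p q (- d)) < 0"
    using l(2) by (simp only: dot_opposite dot_minus)
  then show "\<exists>l \<in> set (map (\<lambda>l. l + 4) L). dot l (w - v - \<mu> - value_of p q (- d)) < 0"
    using l(1) by (intro bexI[of _ "l + 4"]) auto
qed

end

section \<open>Consequences of the invariant\<close>

lemma rotate_period:
  assumes "\<And>i. a (i + 2) = map rot (a i)"
  shows "a (i + 8 :: int) = a i"
proof -
  have "i + 8 = i + 2 + 2 + 2 + 2" by simp
  then have "a (i + 8) = map rot (map rot (map rot (map rot (a i))))" by (simp only: assms)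
  then show ?thesis by (simp add: rot_rot o_def)
qed

lemma rotate_mod:
  assumes "\<And>i. a (i + 2) = map rot (a i)"
  shows "a (i mod 8 :: int) = a i"
proof -
  have *: "a (j + 8 * int n) = a j" for j n
  proof (induction n)
    case (Suc n)
    have "j + 8 * int (Suc n) = j + 8 * int n + 8" by simp
    then show ?case using rotate_period[of a, OF assms] Suc by metis
  qed simp
  from *[of "i mod 8" "nat (i div 8)"] *[of i "nat (- (i div 8))"] show ?thesis
    by (cases "i div 8 \<ge> 0") (simp_all add: minus_mult_div_eq_mod)
qed

text \<open>A cycle with parameters \<open>(p, q)\<close> that satisfies the invariant; all cycles of the construction are of this form.\<close>
locale lifted = move_set +
  fixes a :: path_cycle and p q :: int
  assumes invariant: "lift_invariant a p q"
begin

lemma params: "0 < p" "p < q"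
  and nonempty: "a i \<noteq> []"
  and rotate: "a (i + 2) = map rot (a i)"
  and turn: "map (\<lambda>v. v + value_of p q (mv k)) (a (k + 4) @ a (k + 5)) = rev (a k @ a (k + 1))"
  and bounded: "v \<in> set (a i) \<Longrightarrow> \<mu> \<in> near \<Longrightarrow> f \<in> set (bounds i k) \<Longrightarrow>
    2 * dot k v + dot k \<mu> < fst f * p + snd f * q"
  and cone_apart: "c \<in> set (cones i d) \<Longrightarrow> apart a p q i (i + d) (fst c) (snd c)"
  and move_apart: "(i - k) mod 8 \<notin> {4, 5} \<Longrightarrow> (j - k) mod 8 \<notin> {0, 1} \<Longrightarrow> apart a p q i j (mv k) all_dirs"
  and path: "induced_path adj (a i)"
  and join: "joined adj (a i) (a (i + 1))"
  using invariant unfolding lift_invariant_def by blast+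

lemma period: "a (i + 8) = a i" by (rule rotate_period[of a, OF rotate])

lemma a_mod: "a (i mod 8) = a i" by (rule rotate_mod[of a, OF rotate])

lemma a_cong: "(i - j) mod 8 = 0 \<Longrightarrow> a i = a j"
  using a_mod[of i] a_mod[of j] by (metis mod_eq_dvd_iff dvd_eq_mod_eq_0)

lemma apart_zero:
  assumes "apart a p q i j 0 L" "v \<in> set (a i)" "w \<in> set (a j)"
  shows "w - v \<notin> near"
proof
  assume "w - v \<in> near"
  then obtain l where "dot l (w - v - (w - v) - value_of p q 0) < 0"
    using assms unfolding apart_def by blast
  then show False by (simp add: value_of_0 dot_def)
qed

lemma far:
  assumes d: "d \<in> {2, 3, 4, 5, 6}" and v: "v \<in> set (a i)" and w: "w \<in> set (a (i + d))"
  shows "w - v \<notin> near"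
proof -
  have base: "y - x \<notin> near" if e: "e = 2 \<or> e = 3 \<or> e = 4" and "x \<in> set (a j)" "y \<in> set (a (j + e))" for e x y j
  proof -
    have "\<exists>L. (0, L) \<in> set (cones j e)" using e by (auto simp: cones_def Let_def)
    then obtain L where "(0, L) \<in> set (cones j e)" by blast
    then have "apart a p q j (j + e) 0 L" using cone_apart by fastforce
    then show ?thesis using apart_zero that(2,3) by blast
  qed
  show ?thesis
  proof (cases "d \<in> {2, 3, 4}")
    case True then show ?thesis using base[of d] v w by blast
  next
    case False
    then have "8 - d = 2 \<or> 8 - d = 3 \<or> 8 - d = 4" using d by auto
    moreover have "v \<in> set (a (i + d + (8 - d)))" using v period[of i] by simp
    ultimately have "v - w \<notin> near" using base w by blast
    then show ?thesis using near_minus[of "w - v"] by simp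
  qed
qed

lemma far_separated: "d \<in> {2, 3, 4, 5, 6} \<Longrightarrow> separated adj (a i) (a (i + d))"
  unfolding separated_def using far near_iff by blast

lemma disjoint_next: "v \<in> set (a i) \<Longrightarrow> v \<notin> set (a (i + 1))"
  using join[of i] by (auto simp: joined_def)

lemma near_next:
  assumes "v \<in> set (a i)" "w \<in> set (a (i + 1))" "w - v \<in> near"
  shows "v = last (a i)" "w = hd (a (i + 1))"
  using assms join[of i] unfolding near_iff joined_def by blast+

lemma turn_set:
  "v \<in> set (a (k + 4)) \<or> v \<in> set (a (k + 5)) \<longleftrightarrow>
   v + value_of p q (mv k) \<in> set (a k) \<or> v + value_of p q (mv k) \<in> set (a (k + 1))"
proof -
  have "set (map (\<lambda>v. v + value_of p q (mv k)) (a (k + 4) @ a (k + 5))) = set (rev (a k @ a (k + 1)))"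
    by (simp only: turn)
  then have *: "(\<lambda>v. v + value_of p q (mv k)) ` (set (a (k + 4)) \<union> set (a (k + 5))) = set (a k) \<union> set (a (k + 1))"
    by (simp add: image_Un Un_commute)
  show ?thesis
  proof
    assume "v + value_of p q (mv k) \<in> set (a k) \<or> v + value_of p q (mv k) \<in> set (a (k + 1))"
    then have "v + value_of p q (mv k) \<in> (\<lambda>v. v + value_of p q (mv k)) ` (set (a (k + 4)) \<union> set (a (k + 5)))"
      unfolding * by blast
    then show "v \<in> set (a (k + 4)) \<or> v \<in> set (a (k + 5))" by auto
  next
    assume "v \<in> set (a (k + 4)) \<or> v \<in> set (a (k + 5))"
    then show "v + value_of p q (mv k) \<in> set (a k) \<or> v + value_of p q (mv k) \<in> set (a (k + 1))"
      using * by blast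
  qed
qed

lemma turn_ends:
  "hd (a k) = last (a (k + 5)) + value_of p q (mv k)"
  "last (a (k + 1)) = hd (a (k + 4)) + value_of p q (mv k)"
proof -
  have "last (rev (a k @ a (k + 1))) = last (map (\<lambda>v. v + value_of p q (mv k)) (a (k + 4) @ a (k + 5)))"
    by (simp only: turn)
  then show "hd (a k) = last (a (k + 5)) + value_of p q (mv k)"
    using nonempty by (simp add: last_rev last_map last_append)
  have "hd (rev (a k @ a (k + 1))) = hd (map (\<lambda>v. v + value_of p q (mv k)) (a (k + 4) @ a (k + 5)))"
    by (simp only: turn)
  then show "last (a (k + 1)) = hd (a (k + 4)) + value_of p q (mv k)"
    using nonempty by (simp add: hd_rev hd_map hd_append)
qed

lemma move_apart_source:
  assumes st: "s = 4 \<and> t \<in> {3, 4, 5, 6, 7} \<or> s = 5 \<and> t \<in> {2, 3, 4, 5, 6}"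
    and v: "v \<in> set (a (k + s))" and w: "w \<in> set (a (k + t))"
  shows "w - v - value_of p q (mv k) \<notin> near"
proof
  define x where "x = v + value_of p q (mv k)"
  assume "w - v - value_of p q (mv k) \<in> near"
  then have wx: "w - x \<in> near" by (simp add: x_def diff_diff_eq)
  then have xw: "x - w \<in> near" using near_minus[of "w - x"] by simp
  have "x \<in> set (a k) \<or> x \<in> set (a (k + 1))"
    using turn_set[of v k] st v by (auto simp: x_def)
  then consider (0) "x \<in> set (a k)" | (1) "x \<in> set (a (k + 1))" by blast
  then show False
  proof cases
    case 0
    then have "t \<notin> {2, 3, 4, 5, 6}" using far[of t x k w] w wx by blast
    then have s: "s = 4" and t: "t = 7" using st by auto
    have "x = hd (a k)"
      using near_next(2)[of w "k + 7" x] w t 0 xw a_cong[of "k + 7 + 1" k] by simp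
    then have "v = last (a (k + 5))" using turn_ends(1)[of k] by (simp add: x_def)
    moreover have "a (k + 4 + 1) = a (k + 5)" by (rule a_cong) simp
    ultimately have "v \<in> set (a (k + 4 + 1))" using nonempty by simp
    then show False using disjoint_next v s by blast
  next
    case 1
    have "k + 1 + (t - 1) = k + t" by simp
    then have "t - 1 \<notin> {2, 3, 4, 5, 6}" using far[of "t - 1" x "k + 1" w] w wx 1 by metis
    then have s: "s = 5" and t: "t = 2" using st by auto
    have "x = last (a (k + 1))"
      using near_next(1)[of x "k + 1" w] w t 1 wx a_cong[of "k + 1 + 1" "k + 2"] by simp
    then have "v = hd (a (k + 4))" using turn_ends(2)[of k] by (simp add: x_def)
    then have "v \<in> set (a (k + 4))" using nonempty by simp
    then show False using disjoint_next[of v "k + 4"] v s a_cong[of "k + 4 + 1" "k + 5"] by simp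
  qed
qed

text \<open>If \<open>a i\<close> or \<open>a j\<close> takes part in the translation by \<open>m\<^sub>k\<close>, the translate of a square is again on the board,
  and two squares of the board are near each other only on the same or on consecutive paths.\<close>
lemma move_apart_linked:
  assumes "((i - k) mod 8, (j - k) mod 8) \<notin> set linked_pairs"
  shows "apart a p q i j (mv k) all_dirs"
proof -
  define s t where "s = (i - k) mod 8" and "t = (j - k) mod 8"
  have st: "(s, t) \<notin> set linked_pairs" using assms by (simp add: s_def t_def)
  have s8: "s = 0 \<or> s = 1 \<or> s = 2 \<or> s = 3 \<or> s = 4 \<or> s = 5 \<or> s = 6 \<or> s = 7"
    and t8: "t = 0 \<or> t = 1 \<or> t = 2 \<or> t = 3 \<or> t = 4 \<or> t = 5 \<or> t = 6 \<or> t = 7"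
    unfolding s_def t_def by presburger+
  have ai: "a i = a (k + s)" and aj: "a j = a (k + t)"
    by (rule a_cong; simp add: s_def t_def mod_diff_right_eq diff_diff_eq[symmetric])+
  consider (source) "s \<in> {4, 5}" | (target) "s \<notin> {4, 5}" "t \<in> {0, 1}" | (none) "s \<notin> {4, 5}" "t \<notin> {0, 1}"
    by blast
  then show ?thesis
  proof cases
    case source
    then have "s = 4 \<and> t \<in> {3, 4, 5, 6, 7} \<or> s = 5 \<and> t \<in> {2, 3, 4, 5, 6}"
      using st t8 by (auto simp: linked_pairs_def)
    then show ?thesis
      using move_apart_source[of s t] by (intro apart_pointI) (auto simp: ai aj)
  next
    case target
    define s' t' where "s' = t + 4" and "t' = (if s < 4 then s + 4 else s - 4)"
    have "s' = 4 \<and> t' \<in> {3, 4, 5, 6, 7} \<or> s' = 5 \<and> t' \<in> {2, 3, 4, 5, 6}"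
      using target st s8 by (auto simp: linked_pairs_def s'_def t'_def)
    moreover have "a j = a (k + 4 + s')" "a i = a (k + 4 + t')"
      unfolding ai aj by (rule a_cong; simp add: s'_def t'_def)+
    ultimately have *: "w - v - value_of p q (mv (k + 4)) \<notin> near" if "v \<in> set (a j)" "w \<in> set (a i)" for v w
      using move_apart_source[of s' t' v "k + 4" w] that by simp
    show ?thesis
    proof (rule apart_pointI)
      fix v w assume "v \<in> set (a i)" "w \<in> set (a j)"
      then have "v - w - value_of p q (mv (k + 4)) \<notin> near" using * by blast
      moreover have "v - w - value_of p q (mv (k + 4)) = - (w - v - value_of p q (mv k))"
        by (simp add: mv_opposite value_of_minus)
      ultimately show "w - v - value_of p q (mv k) \<notin> near" by (simp only: near_minus not_False_eq_True)
    qed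
  next
    case none
    then show ?thesis using move_apart[of i k j] by (simp add: s_def t_def)
  qed
qed

end

section \<open>A sufficient test for separation\<close>

text \<open>Quantifiers over lists, in a form that is evaluated from left to right and stops early.\<close>
fun some :: "('a \<Rightarrow> bool) \<Rightarrow> 'a list \<Rightarrow> bool" where
  "some P [] = False"
| "some P (x # xs) = (if P x then True else some P xs)"

fun every :: "('a \<Rightarrow> bool) \<Rightarrow> 'a list \<Rightarrow> bool" where
  "every P [] = True"
| "every P (x # xs) = (if P x then every P xs else False)"

lemma some_iff: "some P xs \<longleftrightarrow> (\<exists>x \<in> set xs. P x)" by (induction xs) auto
lemma every_iff: "every P xs \<longleftrightarrow> (\<forall>x \<in> set xs. P x)" by (induction xs) auto

text \<open>The form \<open>c\<^sub>1 p + c\<^sub>2 q = (c\<^sub>1 + c\<^sub>2) p + c\<^sub>2 (q - p)\<close> is nonnegative for all \<open>0 < p < q\<close>.\<close>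
definition nonneg :: "square \<Rightarrow> bool" where
  "nonneg c \<longleftrightarrow> 0 \<le> snd c \<and> 0 \<le> fst c + snd c"

text \<open>The direction \<open>l\<close> occurs in \<open>L\<close> modulo 8.\<close>
definition covers :: "int list \<Rightarrow> int \<Rightarrow> bool" where
  "covers L l \<longleftrightarrow> some (\<lambda>l'. (l' - l) mod 8 = 0) L"

text \<open>The cone with apex \<open>d\<close> and directions \<open>L\<close> is contained in the cone \<open>c\<close>, because \<open>L\<close> contains the directions
  of \<open>c\<close> and \<open>d\<close> lies in \<open>c\<close>.\<close>
definition implies :: "form \<times> int list \<Rightarrow> form \<Rightarrow> int list \<Rightarrow> bool" where
  "implies c d L \<longleftrightarrow> every (\<lambda>l. if covers L l then nonneg (form_dot l (d - fst c)) else False) (snd c)"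

text \<open>A separation statement implied by a single one of the invariant or of \<open>move_apart_linked\<close>, possibly with the two
  paths exchanged.\<close>
definition known :: "int \<Rightarrow> int \<Rightarrow> form \<Rightarrow> int list \<Rightarrow> bool" where
  "known i j d L \<longleftrightarrow>
    (if some (\<lambda>c. implies c d L) (cones i ((j - i) mod 8)) then True
     else if some (\<lambda>c. implies c (- d) (map (\<lambda>l. l + 4) L)) (cones j ((i - j) mod 8)) then True
     else if L \<noteq> all_dirs then False
     else some (\<lambda>k. if d = mv k then ((i - k) mod 8, (j - k) mod 8) \<notin> set linked_pairs else False) all_dirs)"

text \<open>A separation statement that follows from the extents of the two paths in a single direction \<open>l\<close> of \<open>L\<close>.\<close>
definition bounded_apart :: "int \<Rightarrow> int \<Rightarrow> form \<Rightarrow> int list \<Rightarrow> bool" where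
  "bounded_apart i j d L \<longleftrightarrow> some (\<lambda>l. let x = form_dot l d; y = x + x; gs = bounds i (l + 4) in
     some (\<lambda>f. some (\<lambda>g. nonneg (y - f - g)) gs) (bounds j l)) L"

text \<open>A separation statement for \<open>a i\<close> may be replaced by one for \<open>a k\<close> and one for \<open>a (k + 1)\<close>, where
  translation by \<open>m\<^sub>k\<close> carries \<open>a i\<close> into their union; similarly for \<open>a j\<close>. The number of such steps is
  bounded by the first argument.\<close>
fun sep :: "nat \<Rightarrow> int \<Rightarrow> int \<Rightarrow> form \<Rightarrow> int list \<Rightarrow> bool" where
  "sep 0 i j d L = (if bounded_apart i j d L then True else known i j d L)"
| "sep (Suc n) i j d L =
    (if bounded_apart i j d L then True else if known i j d L then True
     else if some (\<lambda>k. if sep n k j (d - mv k) L then sep n (k + 1) j (d - mv k) L else False) [i + 4, i + 3] then True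
     else some (\<lambda>k. if sep n i k (d + mv k) L then sep n i (k + 1) (d + mv k) L else False) [j + 4, j + 3])"

context lifted
begin

lemma apart_cong:
  "(i - i') mod 8 = 0 \<Longrightarrow> (j - j') mod 8 = 0 \<Longrightarrow> apart a p q i j d L \<longleftrightarrow> apart a p q i' j' d L"
  unfolding apart_def using a_cong[of i i'] a_cong[of j j'] by simp

lemma nonneg_value: "nonneg c \<Longrightarrow> 0 \<le> p * fst c + q * snd c"
proof -
  assume "nonneg c"
  then have "0 \<le> p * (fst c + snd c) + (q - p) * snd c"
    using params unfolding nonneg_def
    by (intro add_nonneg_nonneg[OF mult_nonneg_nonneg mult_nonneg_nonneg]) simp_all
  then show ?thesis by (simp add: algebra_simps)
qed

lemma apart_implies:
  assumes "apart a p q i j (fst c) (snd c)" and imp: "implies c d L"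
  shows "apart a p q i j d L"
  unfolding apart_def
proof (intro ballI)
  fix v w \<mu> assume "v \<in> set (a i)" "w \<in> set (a j)" "\<mu> \<in> near"
  then obtain l where l: "l \<in> set (snd c)" "dot l (w - v - \<mu> - value_of p q (fst c)) < 0"
    using assms(1) unfolding apart_def by blast
  then obtain l' where l': "l' \<in> set L" "(l' - l) mod 8 = 0" and nn: "nonneg (form_dot l (d - fst c))"
    using imp unfolding implies_def every_iff covers_def some_iff by (metis (no_types, lifting))
  have "0 \<le> dot l (value_of p q d - value_of p q (fst c))"
    using nonneg_value[OF nn] by (simp add: dot_value_of flip: value_of_diff)
  then have "dot l (w - v - \<mu> - value_of p q d) < 0" using l(2) by (simp add: dot_diff)
  then show "\<exists>l \<in> set L. dot l (w - v - \<mu> - value_of p q d) < 0"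
    unfolding dot_cong[OF l'(2), symmetric] using l'(1) by blast
qed

lemma apart_bounded:
  assumes "bounded_apart i j d L"
  shows "apart a p q i j d L"
proof -
  obtain l f g where l: "l \<in> set L" and f: "f \<in> set (bounds j l)" and g: "g \<in> set (bounds i (l + 4))"
    and nn: "nonneg (form_dot l d + form_dot l d - f - g)"
    using assms by (auto simp: bounded_apart_def some_iff Let_def)
  show ?thesis unfolding apart_def
  proof (intro ballI)
    fix v w \<mu> assume v: "v \<in> set (a i)" and w: "w \<in> set (a j)" and \<mu>: "\<mu> \<in> near"
    have "2 * dot l w + dot l (- \<mu>) < fst f * p + snd f * q"
      using bounded[OF w _ f] near_minus \<mu> by blast
    moreover have "2 * dot (l + 4) v + dot (l + 4) \<mu> < fst g * p + snd g * q"
      by (rule bounded[OF v \<mu> g])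
    ultimately have "2 * dot l (w - v - \<mu>) < p * (fst f + fst g) + q * (snd f + snd g)"
      by (simp add: dot_opposite dot_minus dot_diff distrib_left mult.commute)
    moreover have "p * (fst f + fst g) + q * (snd f + snd g) \<le> 2 * dot l (value_of p q d)"
      using nonneg_value[OF nn] by (simp add: dot_value_of algebra_simps)
    ultimately have "dot l (w - v - \<mu> - value_of p q d) < 0" by (simp add: dot_diff)
    then show "\<exists>l \<in> set L. dot l (w - v - \<mu> - value_of p q d) < 0" using l by blast
  qed
qed

lemma apart_known:
  assumes "known i j d L"
  shows "apart a p q i j d L"
proof -
  consider c where "c \<in> set (cones i ((j - i) mod 8))" "implies c d L"
    | c where "c \<in> set (cones j ((i - j) mod 8))" "implies c (- d) (map (\<lambda>l. l + 4) L)"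
    | k where "L = all_dirs" "d = mv k" "((i - k) mod 8, (j - k) mod 8) \<notin> set linked_pairs"
    using assms by (auto simp: known_def some_iff split: if_splits)
  then show ?thesis
  proof cases
    case 1
    have "apart a p q i (i + (j - i) mod 8) d L"
      by (rule apart_implies[OF cone_apart[OF 1(1)] 1(2)])
    moreover have "(i + (j - i) mod 8 - j) mod 8 = 0" by presburger
    ultimately show ?thesis using apart_cong[of i i] by simp
  next
    case 2
    have "apart a p q j (j + (i - j) mod 8) (- d) (map (\<lambda>l. l + 4) L)"
      by (rule apart_implies[OF cone_apart[OF 2(1)] 2(2)])
    moreover have "(j + (i - j) mod 8 - i) mod 8 = 0" by presburger
    ultimately have "apart a p q j i (- d) (map (\<lambda>l. l + 4) L)" using apart_cong[of j j] by simp
    then have *: "apart a p q i j d (map (\<lambda>l. l + 8) L)"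
      using apart_swap[of a p q j i "- d" "map (\<lambda>l. l + 4) L"] by (simp add: o_def add.assoc)
    have "dot (l + 8) x = dot l x" for l x by (rule dot_cong) simp
    then show ?thesis using * by (simp add: apart_def)
  next
    case 3 then show ?thesis using move_apart_linked by simp
  qed
qed

lemma apart_source_step:
  assumes "k = i + 4 \<or> k = i + 3"
    and "apart a p q k j (d - mv k) L" "apart a p q (k + 1) j (d - mv k) L"
  shows "apart a p q i j d L"
  unfolding apart_def
proof (intro ballI)
  fix v w \<mu> assume v: "v \<in> set (a i)" and w: "w \<in> set (a j)" "\<mu> \<in> near"
  have "v \<in> set (a (k + 4)) \<or> v \<in> set (a (k + 5))"
    using assms(1) v a_cong[of "k + 4" i] a_cong[of "k + 5" i] by auto
  then have "v + value_of p q (mv k) \<in> set (a k) \<or> v + value_of p q (mv k) \<in> set (a (k + 1))"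
    by (simp add: turn_set)
  then have "\<exists>l \<in> set L. dot l (w - (v + value_of p q (mv k)) - \<mu> - value_of p q (d - mv k)) < 0"
    using assms(2,3) w unfolding apart_def by blast
  then show "\<exists>l \<in> set L. dot l (w - v - \<mu> - value_of p q d) < 0"
    by (simp add: value_of_diff algebra_simps)
qed

lemma apart_target_step:
  assumes "k = j + 4 \<or> k = j + 3"
    and "apart a p q i k (d + mv k) L" "apart a p q i (k + 1) (d + mv k) L"
  shows "apart a p q i j d L"
  unfolding apart_def
proof (intro ballI)
  fix v w \<mu> assume v: "v \<in> set (a i)" and w: "w \<in> set (a j)" and \<mu>: "\<mu> \<in> near"
  have "w \<in> set (a (k + 4)) \<or> w \<in> set (a (k + 5))"
    using assms(1) w a_cong[of "k + 4" j] a_cong[of "k + 5" j] by auto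
  then have "w + value_of p q (mv k) \<in> set (a k) \<or> w + value_of p q (mv k) \<in> set (a (k + 1))"
    by (simp add: turn_set)
  then have "\<exists>l \<in> set L. dot l (w + value_of p q (mv k) - v - \<mu> - value_of p q (d + mv k)) < 0"
    using assms(2,3) v \<mu> unfolding apart_def by blast
  then show "\<exists>l \<in> set L. dot l (w - v - \<mu> - value_of p q d) < 0"
    by (simp add: value_of_add algebra_simps)
qed

lemma apart_sep: "sep n i j d L \<Longrightarrow> apart a p q i j d L"
proof (induction n arbitrary: i j d)
  case 0 then show ?case using apart_bounded apart_known by (auto split: if_splits)
next
  case (Suc n)
  consider "bounded_apart i j d L" | "known i j d L"
    | k where "k = i + 4 \<or> k = i + 3" "sep n k j (d - mv k) L" "sep n (k + 1) j (d - mv k) L"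
    | k where "k = j + 4 \<or> k = j + 3" "sep n i k (d + mv k) L" "sep n i (k + 1) (d + mv k) L"
    using Suc.prems unfolding sep.simps some_iff by (auto simp only: list.set split: if_splits)
  then show ?case
  proof cases
    case 1 then show ?thesis by (rule apart_bounded)
  next
    case 2 then show ?thesis by (rule apart_known)
  next
    case 3 then show ?thesis using apart_source_step Suc.IH by blast
  next
    case 4 then show ?thesis using apart_target_step Suc.IH by blast
  qed
qed

end

section \<open>Invariance under lifting\<close>

text \<open>The action of the matrix of a type on the parameters.\<close>
fun lift_params :: "type_char \<Rightarrow> int \<times> int \<Rightarrow> int \<times> int" where
  "lift_params Tf (p, q) = (p, 2 * p + q)"
| "lift_params Tg (p, q) = (q, 2 * q - p)"
| "lift_params Th (p, q) = (q, p + 2 * q)"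
| "lift_params Thbar (p, q) = (q, p + 2 * q)"

text \<open>A form in the new parameters, rewritten as a form in the old ones.\<close>
fun subst :: "type_char \<Rightarrow> 'b::ab_group_add \<times> 'b \<Rightarrow> 'b \<times> 'b" where
  "subst Tf (x, y) = (x + y + y, y)"
| "subst Tg (x, y) = (- y, x + y + y)"
| "subst Th (x, y) = (y, x + y + y)"
| "subst Thbar (x, y) = (y, x + y + y)"

text \<open>The path \<open>i\<close> of a lift is the concatenation of the translates of \<open>a j\<close>, all or none of them reversed, by
  the form \<open>d\<close>, for the listed pairs \<open>(j, d)\<close>.\<close>
fun pieces :: "type_char \<Rightarrow> int \<Rightarrow> (int \<times> form) list" where
  "pieces Tf i = (if even i then map (\<lambda>j. (j, along (1, 1) i)) [i + 5, i + 4, i + 3]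
     else [(i, along (1, 0) i)])"
| "pieces Tg i = (if even i then [(i, along (-1, 1) i)]
     else map (\<lambda>j. (j, along (0, 1) i)) [i + 5, i + 4, i + 3])"
| "pieces Th i = (if even i then map (\<lambda>j. (j, along (1, 1) i)) [i + 6, i + 5, i + 4, i + 3, i + 2]
     else map (\<lambda>j. (j, along (0, 1) i)) [i - 1, i, i + 1])"
| "pieces Thbar i = (if even i then map (\<lambda>j. (j, along (1, 1) i)) [i - 1, i, i + 1]
     else map (\<lambda>j. (j, along (0, 1) i)) [i + 6, i + 5, i + 4, i + 3, i + 2])"

text \<open>The old paths are traversed backwards in the path \<open>i\<close> of the lift.\<close>
definition reversing :: "type_char \<Rightarrow> int \<Rightarrow> bool" where
  "reversing t i \<longleftrightarrow> (even i \<longleftrightarrow> t = Tf \<or> t = Th)"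

text \<open>A separation statement for the lift follows from the invariant of the original cycle by at most two translations
  for each pair of pieces. The list \<open>L\<close> of directions is unchanged.\<close>
definition reduces :: "type_char \<Rightarrow> int \<Rightarrow> int \<Rightarrow> form \<Rightarrow> int list \<Rightarrow> bool" where
  "reduces t i j d L \<longleftrightarrow> (let d' = subst t d in every (\<lambda>x. let e = d' + snd x in every (\<lambda>y.
     sep 2 (fst x mod 8) (fst y mod 8) (e - snd y) L) (pieces t j)) (pieces t i))"

text \<open>The following predicates express that a part of the invariant is inherited by the lift of type \<open>t\<close>.\<close>
definition cones_lift :: "type_char \<Rightarrow> int \<Rightarrow> bool" where
  "cones_lift t i \<longleftrightarrow> every (\<lambda>d. every (\<lambda>c. reduces t i (i + d) (fst c) (snd c)) (cones i d)) [2, 3, 4]"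

definition moves_lift :: "type_char \<Rightarrow> int \<Rightarrow> int \<Rightarrow> bool" where
  "moves_lift t k i \<longleftrightarrow> (if (i - k) mod 8 = 4 \<or> (i - k) mod 8 = 5 then True else
     every (\<lambda>j. if (j - k) mod 8 = 0 \<or> (j - k) mod 8 = 1 then True else reduces t i j (mv k) all_dirs) all_dirs)"

definition bounds_lift :: "type_char \<Rightarrow> int \<Rightarrow> bool" where
  "bounds_lift t i \<longleftrightarrow> every (\<lambda>k. every (\<lambda>f. every (\<lambda>x.
     some (\<lambda>g. nonneg (subst t f - form_dot k (snd x) - form_dot k (snd x) - g)) (bounds (fst x mod 8) k))
     (pieces t i)) (bounds i k)) all_dirs"

text \<open>The last piece of the path \<open>i\<close> of the lift is joined to the first piece of the path \<open>i + 1\<close>, as in \<open>link_reversed\<close>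
  or \<open>link_forward\<close> below, and all other pairs of pieces are separated.\<close>
definition links_lift :: "type_char \<Rightarrow> int \<Rightarrow> bool" where
  "links_lift t i \<longleftrightarrow> (let xs = pieces t i; ys = pieces t (i + 1); x = last xs; y = hd ys in
     every (\<lambda>x. every (\<lambda>y. sep 2 (fst x mod 8) (fst y mod 8) (snd x - snd y) all_dirs) ys) (butlast xs)
     \<and> every (\<lambda>y. sep 2 (fst x mod 8) (fst y mod 8) (snd x - snd y) all_dirs) (tl ys)
     \<and> (fst x - 2 - fst y) mod 8 = 0
     \<and> (if reversing t i then snd x - snd y = mv (fst x + 4) else snd y - snd x = mv (fst x + 1)))"

text \<open>Finite calculations with the coefficients of \<open>p\<close> and \<open>q\<close>.\<close>
lemma links_lift: "links_lift t 0" "links_lift t 1" by (induct t; code_simp)+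
lemma bounds_lift: "bounds_lift t 0" "bounds_lift t 1" by (induct t; code_simp)+

lemma value_along: "value_of p q (along c k) = scale (fst c * p + snd c * q) (udir k)"
  by (simp add: value_of_def along_def scale_def algebra_simps)

lemma pieces_nonempty: "pieces t i \<noteq> []" by (cases t) auto

lemma all_shift: "(\<forall>k::int. P k) \<longleftrightarrow> (\<forall>k. P (k + 2))"
proof
  assume R: "\<forall>k. P (k + 2)"
  show "\<forall>k. P k"
  proof
    fix k show "P k" using R[rule_format, of "k - 2"] by simp
  qed
qed simp

lemma rotf_0: "rotf 0 = 0" by (simp add: rotf_def rot_def zero_prod_def)

lemma cones_rot: "cones (i + 2) d = map (\<lambda>c. (rotf (fst c), map (\<lambda>l. l + 2) (snd c))) (cones i d)"
  unfolding cones_def Let_def by (auto simp: ray_def wedge_def rotf_0 along_rot[symmetric] algebra_simps)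

lemma pieces_rot: "pieces t (i + 2) = map (\<lambda>x. (fst x + 2, rotf (snd x))) (pieces t i)"
  by (cases t) (auto simp: along_rot[symmetric] algebra_simps)

lemma reversing_rot: "reversing t (i + 2) = reversing t i" by (simp add: reversing_def)

lemma reversing_next: "reversing t (i + 1) = (\<not> reversing t i)"
  unfolding reversing_def by (cases "t = Tf \<or> t = Th") auto

lemma lift_pieces:
  assumes "P $ 1 = p" "P $ 2 = q"
  shows "lift t P a i = concat (map (\<lambda>x. map (\<lambda>v. v + value_of p q (snd x))
    ((if reversing t i then rev else id) (a (fst x)))) (pieces t i))"
  using assms by (cases t) (simp_all add: reversing_def translate_def value_along)

context move_set
begin

text \<open>By rotation symmetry, the invariant needs to be verified for two representatives of the index only.\<close>
lemma lift_invariantI: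
  assumes pq: "0 < p" "p < q" and ne: "\<And>i. a i \<noteq> []" and rotate: "\<And>i. a (i + 2) = map rot (a i)"
    and turn: "\<And>k. k = 0 \<or> k = 1 \<Longrightarrow>
      map (\<lambda>v. v + value_of p q (mv k)) (a (k + 4) @ a (k + 5)) = rev (a k @ a (k + 1))"
    and bounded: "\<And>i k v \<mu> f. i = 0 \<or> i = 1 \<Longrightarrow> k \<in> set all_dirs \<Longrightarrow> v \<in> set (a i) \<Longrightarrow> \<mu> \<in> near \<Longrightarrow>
      f \<in> set (bounds i k) \<Longrightarrow> 2 * dot k v + dot k \<mu> < fst f * p + snd f * q"
    and cone: "\<And>i d c. i = 0 \<or> i = 1 \<Longrightarrow> c \<in> set (cones i d) \<Longrightarrow> apart a p q i (i + d) (fst c) (snd c)"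
    and moves: "\<And>k i j. k = 0 \<or> k = 1 \<Longrightarrow> i \<in> set all_dirs \<Longrightarrow> j \<in> set all_dirs \<Longrightarrow>
      (i - k) mod 8 \<notin> {4, 5} \<Longrightarrow> (j - k) mod 8 \<notin> {0, 1} \<Longrightarrow> apart a p q i j (mv k) all_dirs"
    and path: "\<And>i. induced_path adj (a i)"
    and join: "\<And>i. i = 0 \<or> i = 1 \<Longrightarrow> joined adj (a i) (a (i + 1))"
  shows "lift_invariant a p q"
proof -
  have mod8: "m mod 8 \<in> set all_dirs" for m :: int
    unfolding all_dirs_def by (cases m rule: mod8_cases) simp_all
  have a_mod: "a (i mod 8) = a i" for i by (rule rotate_mod[of a, OF rotate])
  have inj: "map rot xs = map rot ys \<longleftrightarrow> xs = ys" for xs ys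
    by (rule inj_map_eq_map) (simp add: inj_on_def rot_eq_iff)
  have turns: "map (\<lambda>v. v + value_of p q (mv k)) (a (k + 4) @ a (k + 5)) = rev (a k @ a (k + 1))" for k
  proof (rule parity_extend[where i = k])
    fix k :: int
    have e: "k + 2 + 4 = k + 4 + 2" "k + 2 + 5 = k + 5 + 2" "k + 2 + 1 = k + 1 + 2" by simp_all
    have m1: "map (\<lambda>v. v + value_of p q (mv (k + 2))) (a (k + 2 + 4) @ a (k + 2 + 5)) =
      map rot (map (\<lambda>v. v + value_of p q (mv k)) (a (k + 4) @ a (k + 5)))"
      unfolding e rotate mv_rot value_of_rotf by (simp add: rot_add)
    have m2: "rev (a (k + 2) @ a (k + 2 + 1)) = map rot (rev (a k @ a (k + 1)))"
      unfolding e rotate by (simp add: rev_map)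
    show "map (\<lambda>v. v + value_of p q (mv (k + 2))) (a (k + 2 + 4) @ a (k + 2 + 5)) = rev (a (k + 2) @ a (k + 2 + 1))
      \<longleftrightarrow> map (\<lambda>v. v + value_of p q (mv k)) (a (k + 4) @ a (k + 5)) = rev (a k @ a (k + 1))"
      by (simp only: m1 m2 inj)
  qed (use turn in blast)+
  let ?B = "\<lambda>i k v \<mu>. \<forall>f \<in> set (bounds i k). 2 * dot k v + dot k \<mu> < fst f * p + snd f * q"
  have bounds: "\<forall>k. \<forall>v \<in> set (a i). \<forall>\<mu> \<in> near. ?B i k v \<mu>" for i
  proof (rule parity_extend[where i = i])
    fix i
    have "(\<forall>k. \<forall>v \<in> set (a (i + 2)). \<forall>\<mu> \<in> near. ?B (i + 2) k v \<mu>) \<longleftrightarrow>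
      (\<forall>k. \<forall>v \<in> set (a (i + 2)). \<forall>\<mu> \<in> near. ?B (i + 2) (k + 2) v \<mu>)"
      by (rule all_shift)
    also have "\<dots> \<longleftrightarrow> (\<forall>k. \<forall>v \<in> set (a i). \<forall>\<mu> \<in> near. ?B (i + 2) (k + 2) (rot v) (rot \<mu>))"
      unfolding rotate by (subst near_all_rot) simp
    also have "\<dots> \<longleftrightarrow> (\<forall>k. \<forall>v \<in> set (a i). \<forall>\<mu> \<in> near. ?B i k v \<mu>)"
      by (simp only: bounds_shift dot_rot)
    finally show "(\<forall>k. \<forall>v \<in> set (a (i + 2)). \<forall>\<mu> \<in> near. ?B (i + 2) k v \<mu>) \<longleftrightarrow>
      (\<forall>k. \<forall>v \<in> set (a i). \<forall>\<mu> \<in> near. ?B i k v \<mu>)" .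
  next
    have base: "\<forall>k. \<forall>v \<in> set (a i). \<forall>\<mu> \<in> near. ?B i k v \<mu>" if i: "i = 0 \<or> i = 1" for i
    proof (intro allI ballI)
      fix k v \<mu> f assume *: "v \<in> set (a i)" "\<mu> \<in> near" "f \<in> set (bounds i k)"
      have "bounds i (k mod 8) = bounds i k" by (rule bounds_cong) (simp_all add: mod_diff_left_eq)
      then show "2 * dot k v + dot k \<mu> < fst f * p + snd f * q"
        using bounded[OF i mod8[of k] *(1,2)] *(3) by simp
    qed
    show "\<forall>k. \<forall>v \<in> set (a 0). \<forall>\<mu> \<in> near. ?B 0 k v \<mu>" "\<forall>k. \<forall>v \<in> set (a 1). \<forall>\<mu> \<in> near. ?B 1 k v \<mu>"
      by (rule base; simp)+
  qed
  have cones: "\<forall>c \<in> set (cones i d). apart a p q i (i + d) (fst c) (snd c)" for i d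
  proof (rule parity_extend[where P = "\<lambda>i. \<forall>c \<in> set (cones i d). apart a p q i (i + d) (fst c) (snd c)"])
    fix i
    have e: "i + 2 + d = i + d + 2" by simp
    show "(\<forall>c \<in> set (cones (i + 2) d). apart a p q (i + 2) (i + 2 + d) (fst c) (snd c)) \<longleftrightarrow>
      (\<forall>c \<in> set (cones i d). apart a p q i (i + d) (fst c) (snd c))"
      by (simp only: e cones_rot list.set_map ball_simps(9) fst_conv snd_conv apart_rot[of a, OF rotate])
  qed (use cone in blast)+
  let ?Q = "\<lambda>k i j. (i - k) mod 8 \<notin> {4, 5} \<longrightarrow> (j - k) mod 8 \<notin> {0, 1} \<longrightarrow> apart a p q i j (mv k) all_dirs"
  have all: "apart a p q i j d all_dirs \<longleftrightarrow>
    (\<forall>v \<in> set (a i). \<forall>w \<in> set (a j). w - v - value_of p q d \<notin> near)" for i j d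
    using apart_point apart_pointI by blast
  have "\<forall>i j. ?Q k i j" for k
  proof (rule parity_extend[where i = k])
    fix k
    have "apart a p q (i + 2) (j + 2) (mv (k + 2)) all_dirs \<longleftrightarrow> apart a p q i j (mv k) all_dirs" for i j
      unfolding all rotate mv_rot value_of_rotf by (simp add: near_rot flip: rot_diff)
    then have step: "?Q (k + 2) (i + 2) (j + 2) \<longleftrightarrow> ?Q k i j" for i j by simp
    have "(\<forall>i j. ?Q (k + 2) i j) \<longleftrightarrow> (\<forall>i j. ?Q (k + 2) (i + 2) (j + 2))"
      by (subst all_shift) (intro iff_allI all_shift)
    also have "\<dots> \<longleftrightarrow> (\<forall>i j. ?Q k i j)" by (simp only: step)
    finally show "(\<forall>i j. ?Q (k + 2) i j) \<longleftrightarrow> (\<forall>i j. ?Q k i j)" .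
  next
    have base: "\<forall>i j. ?Q k i j" if k: "k = 0 \<or> k = 1" for k
    proof (intro allI impI)
      fix i j :: int assume *: "(i - k) mod 8 \<notin> {4, 5}" "(j - k) mod 8 \<notin> {0, 1}"
      then have "apart a p q (i mod 8) (j mod 8) (mv k) all_dirs"
        by (intro moves[OF k mod8 mod8]) (simp_all only: mod_diff_left_eq not_False_eq_True)
      then show "apart a p q i j (mv k) all_dirs" by (simp add: apart_def a_mod)
    qed
    show "\<forall>i j. ?Q 0 i j" "\<forall>i j. ?Q 1 i j" by (rule base; simp)+
  qed
  moreover have "joined adj (a i) (a (i + 1))" for i
  proof (rule parity_extend[where i = i])
    fix i :: int
    have "i + 2 + 1 = i + 1 + 2" by simp
    then have "a (i + 2 + 1) = map rot (a (i + 1))" by (simp only: rotate)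
    then show "joined adj (a (i + 2)) (a (i + 2 + 1)) \<longleftrightarrow> joined adj (a i) (a (i + 1))"
      unfolding rotate using joined_map[of rot adj "a i" "a (i + 1)"] ne
      by (simp add: adj_rot rot_eq_iff inj_on_def)
  qed (use join in blast)+
  ultimately show ?thesis
    unfolding lift_invariant_def using pq ne rotate turns bounds cones path by blast
qed

end

context lifted
begin

lemma join_at: "j = i + 1 \<Longrightarrow> joined adj (a i) (a j)"
  and separated_at: "j - i \<in> {2, 3, 4, 5, 6} \<Longrightarrow> separated adj (a i) (a j)"
  using join[of i] far_separated[of "j - i" i] by simp_all

lemma arc3: "induced_path adj (a i @ a (i + 1) @ a (i + 2))"
proof -
  have "joined adj ([] @ a i) (a (i + 1) @ a (i + 2))"
    by (rule joined_append) (simp_all add: join_at separated_at nonempty separated_def[of _ "[]"])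
  moreover have "induced_path adj (a (i + 1) @ a (i + 2))"
    by (rule induced_path_append) (simp_all add: adj_sym path nonempty join_at)
  ultimately show ?thesis
    using induced_path_append[OF adj_sym path nonempty] nonempty by simp
qed

lemma arc5: "induced_path adj (a i @ a (i + 1) @ a (i + 2) @ a (i + 3) @ a (i + 4))"
proof -
  have sep: "separated adj us (vs @ ws)" if "separated adj us vs" "separated adj us ws" for us vs ws
    using that by (auto simp: separated_def)
  have j: "joined adj (a i @ a (i + 1)) (a (i + 2) @ a (i + 3) @ a (i + 4))"
    by (rule joined_append) (simp_all add: join_at separated_at nonempty sep)
  have p1: "induced_path adj (a i @ a (i + 1))"
    by (rule induced_path_append) (simp_all add: adj_sym path nonempty join_at)
  have p2: "induced_path adj (a (i + 2) @ a (i + 3) @ a (i + 4))"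
    using arc3[of "i + 2"] by (simp add: add.assoc)
  have "induced_path adj ((a i @ a (i + 1)) @ a (i + 2) @ a (i + 3) @ a (i + 4))"
    by (rule induced_path_append[OF adj_sym p1 _ p2 _ j]) (simp_all add: nonempty)
  then show ?thesis by simp
qed

text \<open>In a lift, reversed paths are followed by unreversed ones and conversely. Here a translate of \<open>a j\<close> reversed is
  followed by one of \<open>a (j - 2)\<close>; the relative translation carries \<open>a j\<close> into the union of the two paths that
  precede \<open>a (j - 2)\<close>, so that the claim is one about the original cycle. In \<open>link_forward\<close>, it carries
  \<open>a (j - 2)\<close> into the union of the two paths that follow \<open>a j\<close>.\<close>
lemma link_reversed:
  assumes s: "s - s' = value_of p q (mv (j + 4))" and j: "(j - 2 - j') mod 8 = 0"
  shows "joined adj (map (\<lambda>v. v + s) (rev (a j))) (map (\<lambda>v. v + s') (a j'))"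
proof -
  define m where "m = value_of p q (mv (j + 4))"
  have j': "a j' = a (j + 5 + 1)" "a j' = a (j + 4 + 2)"
  proof -
    have "a j' = a (j - 2)" using a_cong[OF j] by simp
    also have "\<dots> = a (j + 6)" by (rule a_cong) simp
    finally show "a j' = a (j + 5 + 1)" "a j' = a (j + 4 + 2)" by (simp_all add: add.assoc)
  qed
  have j4: "a (j + 4 + 4) = a j" "a (j + 4 + 1) = a (j + 5)" by (rule a_cong, simp)+
  have ends: "last (a (j + 5)) = hd (a j) + m" using turn_ends(2)[of "j + 4"] j4 by (simp add: m_def)
  have main: "x + s \<noteq> y + s' \<and> (adj (x + s) (y + s') \<longleftrightarrow> x = hd (a j) \<and> y = hd (a j'))"
    if x: "x \<in> set (a j)" and y: "y \<in> set (a j')" for x y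
  proof -
    have "s = m + s'" using s by (simp add: m_def diff_eq_eq)
    then have shift: "adj (x + s) (y + s') \<longleftrightarrow> adj (x + m) y" "x + s = y + s' \<longleftrightarrow> x + m = y"
      by (simp_all add: adj_def algebra_simps)
    have "x + m \<in> set (a (j + 4)) \<or> x + m \<in> set (a (j + 4 + 1))"
      using turn_set[of x "j + 4"] x j4 by (simp add: m_def)
    then consider "x + m \<in> set (a (j + 4))" | "x + m \<in> set (a (j + 5))" using j4 by auto
    then show ?thesis
    proof cases
      case 1
      then have "y - (x + m) \<notin> near" using far[of 2 "x + m" "j + 4" y] y[unfolded j'(2)] by blast
      moreover have "x \<noteq> hd (a j)"
      proof
        assume "x = hd (a j)"
        then have "x + m \<in> set (a (j + 4 + 1))" using ends nonempty[of "j + 5"] j4 by (metis last_in_set)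
        then show False using disjoint_next 1 by blast
      qed
      ultimately show ?thesis unfolding shift near_iff by blast
    next
      case 2
      have "x + m \<noteq> y \<and> (adj (x + m) y \<longleftrightarrow> x + m = last (a (j + 5)) \<and> y = hd (a (j + 5 + 1)))"
        using join[of "j + 5"] 2 y unfolding joined_def j'(1) by blast
      then show ?thesis unfolding shift ends j'(1) by simp
    qed
  qed
  have "last (map (\<lambda>v. v + s) (rev (a j))) = hd (a j) + s" "hd (map (\<lambda>v. v + s') (a j')) = hd (a j') + s'"
    using nonempty by (simp_all add: last_map last_rev hd_map)
  then show ?thesis unfolding joined_def using main by auto
qed

lemma link_forward:
  assumes s: "s' - s = value_of p q (mv (j + 1))" and j: "(j - 2 - j') mod 8 = 0"
  shows "joined adj (map (\<lambda>v. v + s) (a j)) (map (\<lambda>v. v + s') (rev (a j')))"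
proof -
  define m where "m = value_of p q (mv (j + 1))"
  have j': "a j' = a (j + 1 + 5)"
  proof -
    have "a j' = a (j - 2)" using a_cong[OF j] by simp
    also have "\<dots> = a (j + 1 + 5)" by (rule a_cong) simp
    finally show ?thesis .
  qed
  have j2: "a (j + 1 + 1) = a (j + 2)" by (rule a_cong) simp
  have ends: "hd (a (j + 1)) = last (a j') + m" using turn_ends(1)[of "j + 1"] j' by (simp add: m_def)
  have main: "x + s \<noteq> y + s' \<and> (adj (x + s) (y + s') \<longleftrightarrow> x = last (a j) \<and> y = last (a j'))"
    if x: "x \<in> set (a j)" and y: "y \<in> set (a j')" for x y
  proof -
    have "s' = m + s" using s by (simp add: m_def diff_eq_eq)
    then have shift: "adj (x + s) (y + s') \<longleftrightarrow> adj x (y + m)" "x + s = y + s' \<longleftrightarrow> x = y + m"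
      by (simp_all add: adj_def algebra_simps)
    have "y + m \<in> set (a (j + 1)) \<or> y + m \<in> set (a (j + 1 + 1))"
      using turn_set[of y "j + 1"] y j' by (simp add: m_def)
    then consider "y + m \<in> set (a (j + 1))" | "y + m \<in> set (a (j + 2))" using j2 by auto
    then show ?thesis
    proof cases
      case 2
      then have "y + m - x \<notin> near" using far[of 2 x j "y + m"] x by blast
      moreover have "y \<noteq> last (a j')"
      proof
        assume "y = last (a j')"
        then have "y + m \<in> set (a (j + 1))" using ends nonempty[of "j + 1"] by (metis hd_in_set)
        then show False using disjoint_next[of "y + m" "j + 1"] 2 unfolding j2 by blast
      qed
      ultimately show ?thesis unfolding shift near_iff by blast
    next
      case 1
      have "x \<noteq> y + m \<and> (adj x (y + m) \<longleftrightarrow> x = last (a j) \<and> y + m = hd (a (j + 1)))"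
        using join[of j] 1 x unfolding joined_def by blast
      then show ?thesis unfolding shift ends by simp
    qed
  qed
  have "last (map (\<lambda>v. v + s) (a j)) = last (a j) + s" "hd (map (\<lambda>v. v + s') (rev (a j'))) = last (a j') + s'"
    using nonempty by (simp_all add: last_map hd_rev hd_map)
  then show ?thesis unfolding joined_def using main by auto
qed

text \<open>Translation of a list, kept folded so that \<open>shift_turn\<close> can rewrite with it.\<close>
definition shift :: "square \<Rightarrow> square list \<Rightarrow> square list" where
  "shift c xs = map (\<lambda>v. v + c) xs"

lemma shift_turn:
  "shift c (rev (a (k + 1))) @ shift c (rev (a k)) @ ys =
   shift (c + value_of p q (mv k)) (a (k + 4)) @ shift (c + value_of p q (mv k)) (a (k + 5)) @ ys"
proof -
  have "shift c (rev (a (k + 1))) @ shift c (rev (a k)) = shift c (rev (a k @ a (k + 1)))"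
    by (simp add: shift_def)
  also have "\<dots> = shift c (map (\<lambda>v. v + value_of p q (mv k)) (a (k + 4) @ a (k + 5)))"
    by (simp only: turn)
  also have "\<dots> = shift (c + value_of p q (mv k)) (a (k + 4)) @ shift (c + value_of p q (mv k)) (a (k + 5))"
    by (simp add: shift_def algebra_simps)
  finally show ?thesis by (metis append.assoc)
qed

end

text \<open>One lift, of type \<open>t\<close>, of a cycle that satisfies the invariant. The primed parameters are those of the lift.\<close>
locale lifting_step = lifted Mv a p q for Mv a p q +
  fixes t :: type_char and P :: "int ^ 2" and p' q' :: int
  assumes P: "P $ 1 = p" "P $ 2 = q" and params': "lift_params t (p, q) = (p', q')"
begin

definition b :: path_cycle where "b = lift t P a"

lemma b_pieces: "b i = concat (map (\<lambda>x. map (\<lambda>v. v + value_of p q (snd x))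
    ((if reversing t i then rev else id) (a (fst x)))) (pieces t i))"
  unfolding b_def by (rule lift_pieces[OF P])

lemma set_b: "set (b i) = (\<Union>x \<in> set (pieces t i). (\<lambda>v. v + value_of p q (snd x)) ` set (a (fst x)))"
  unfolding b_pieces by auto

lemma b_nonempty: "b i \<noteq> []"
  using pieces_nonempty[of t i] nonempty by (cases "pieces t i") (auto simp: b_pieces)

lemma b_rotate: "b (i + 2) = map rot (b i)"
  unfolding b_pieces pieces_rot reversing_rot
  by (simp add: map_concat o_def value_of_rotf rotate rot_add rev_map)

lemma value_subst: "value_of p' q' d = value_of p q (subst t d)"
  using params' by (cases t; cases d) (auto simp: value_of_def scale_def algebra_simps)

lemma linear_subst: "fst f * p' + snd f * q' = fst (subst t f) * p + snd (subst t f) * (q :: int)"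
  using params' by (cases t; cases f) (auto simp: algebra_simps)

lemma b_apart_reduces:
  assumes "reduces t i j d L"
  shows "apart b p' q' i j d L"
  unfolding apart_def
proof (intro ballI)
  fix v w \<mu> assume "v \<in> set (b i)" "w \<in> set (b j)" and \<mu>: "\<mu> \<in> near"
  then obtain x y v0 w0 where x: "x \<in> set (pieces t i)" "v0 \<in> set (a (fst x))" "v = v0 + value_of p q (snd x)"
    and y: "y \<in> set (pieces t j)" "w0 \<in> set (a (fst y))" "w = w0 + value_of p q (snd y)"
    unfolding set_b by blast
  have "sep 2 (fst x mod 8) (fst y mod 8) (subst t d + snd x - snd y) L"
    using assms x(1) y(1) by (simp add: reduces_def Let_def every_iff)
  then have "apart a p q (fst x mod 8) (fst y mod 8) (subst t d + snd x - snd y) L" by (rule apart_sep)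
  then have "\<exists>l \<in> set L. dot l (w0 - v0 - \<mu> - value_of p q (subst t d + snd x - snd y)) < 0"
    using x(2) y(2) \<mu> unfolding apart_def a_mod by blast
  moreover have "w0 - v0 - \<mu> - value_of p q (subst t d + snd x - snd y) = w - v - \<mu> - value_of p' q' d"
    unfolding x(3) y(3) value_subst by (simp add: value_of_add value_of_diff algebra_simps)
  ultimately show "\<exists>l \<in> set L. dot l (w - v - \<mu> - value_of p' q' d) < 0" by simp
qed

lemma b_cones:
  assumes ok: "cones_lift t i" and c: "c \<in> set (cones i d)"
  shows "apart b p' q' i (i + d) (fst c) (snd c)"
proof -
  have "d \<in> {2, 3, 4}" using c by (auto simp: cones_def split: if_splits)
  moreover have "\<forall>d \<in> {2, 3, 4}. \<forall>c \<in> set (cones i d). reduces t i (i + d) (fst c) (snd c)"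
    using ok unfolding cones_lift_def every_iff by simp
  ultimately show ?thesis using c b_apart_reduces by blast
qed

lemma b_moves:
  assumes "moves_lift t k i" "j \<in> set all_dirs" "(i - k) mod 8 \<notin> {4, 5}" "(j - k) mod 8 \<notin> {0, 1}"
  shows "apart b p' q' i j (mv k) all_dirs"
  using assms by (intro b_apart_reduces) (simp add: moves_lift_def every_iff split: if_splits)

lemma b_bounded:
  assumes ok: "bounds_lift t i" and k: "k \<in> set all_dirs"
    and v: "v \<in> set (b i)" and \<mu>: "\<mu> \<in> near" and f: "f \<in> set (bounds i k)"
  shows "2 * dot k v + dot k \<mu> < fst f * p' + snd f * q'"
proof -
  obtain x v0 where x: "x \<in> set (pieces t i)" "v0 \<in> set (a (fst x))" "v = v0 + value_of p q (snd x)"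
    using v unfolding set_b by blast
  have "\<forall>k \<in> set all_dirs. \<forall>f \<in> set (bounds i k). \<forall>x \<in> set (pieces t i).
      \<exists>g \<in> set (bounds (fst x mod 8) k). nonneg (subst t f - form_dot k (snd x) - form_dot k (snd x) - g)"
    using ok unfolding bounds_lift_def every_iff some_iff .
  then obtain g where "g \<in> set (bounds (fst x mod 8) k)"
    and nn: "nonneg (subst t f - form_dot k (snd x) - form_dot k (snd x) - g)"
    using f x(1) k by blast
  then have "2 * dot k v0 + dot k \<mu> < fst g * p + snd g * q"
    using bounded[of v0 "fst x mod 8"] x(2) \<mu> by (simp add: a_mod)
  then show ?thesis
    using nonneg_value[OF nn] unfolding linear_subst x(3) dot_add dot_value_of by (simp add: algebra_simps)
qed

lemma b_path: "induced_path adj (b i)"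
proof -
  have m: "induced_path adj (map (\<lambda>x. x + c) xs) \<longleftrightarrow> induced_path adj xs" for c xs
    by (rule induced_path_map) (auto simp: adj_translate inj_on_def)
  have r3: "induced_path adj (rev (a (i + 5)) @ rev (a (i + 4)) @ rev (a (i + 3)))"
    using arc3[of "i + 3"] induced_path_rev[of adj "a (i + 3) @ a (i + 4) @ a (i + 5)"] by (simp add: add.assoc)
  have r5: "induced_path adj (rev (a (i + 6)) @ rev (a (i + 5)) @ rev (a (i + 4)) @ rev (a (i + 3)) @ rev (a (i + 2)))"
    using arc5[of "i + 2"] induced_path_rev[of adj "a (i + 2) @ a (i + 3) @ a (i + 4) @ a (i + 5) @ a (i + 6)"]
    by (simp add: add.assoc)
  have f3: "induced_path adj (a (i - 1) @ a i @ a (i + 1))"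
  proof -
    have "i - 1 + 1 = i" "i - 1 + 2 = i + 1" by simp_all
    then show ?thesis using arc3[of "i - 1"] by (simp only:)
  qed
  show ?thesis
    unfolding b_def using r3 r5 f3 path[of i] by (cases t) (simp_all add: translate_def m del: map_append rev_append)
qed

lemma sep_separated:
  assumes "sep 2 (fst x mod 8) (fst y mod 8) (snd x - snd y) all_dirs"
    and "v \<in> set (a (fst x))" "w \<in> set (a (fst y))"
  shows "v + value_of p q (snd x) \<noteq> w + value_of p q (snd y)
    \<and> \<not> adj (v + value_of p q (snd x)) (w + value_of p q (snd y))"
proof -
  have "w - v - value_of p q (snd x - snd y) \<notin> near"
    using apart_point[OF apart_sep[OF assms(1)]] assms(2,3) by (simp add: a_mod)
  moreover have "w - v - value_of p q (snd x - snd y) = w + value_of p q (snd y) - (v + value_of p q (snd x))"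
    by (simp add: value_of_diff algebra_simps)
  ultimately show ?thesis using near_iff by metis
qed

lemma b_join:
  assumes ok: "links_lift t i"
  shows "joined adj (b i) (b (i + 1))"
proof -
  define F where "F i x = map (\<lambda>v. v + value_of p q (snd x)) ((if reversing t i then rev else id) (a (fst x)))" for i x
  define xs ys where "xs = pieces t i" and "ys = pieces t (i + 1)"
  define x y where "x = last xs" and "y = hd ys"
  have xs: "xs = butlast xs @ [x]" and ys: "ys = y # tl ys"
    using pieces_nonempty by (simp_all add: xs_def ys_def x_def y_def)
  have bi: "b i = concat (map (F i) (butlast xs)) @ F i x"
    unfolding b_pieces F_def[symmetric] xs_def[symmetric] by (subst xs) simp
  have bj: "b (i + 1) = F (i + 1) y @ concat (map (F (i + 1)) (tl ys))"
    unfolding b_pieces F_def[symmetric] ys_def[symmetric] by (subst ys) simp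
  have setF: "set (F i x) = (\<lambda>v. v + value_of p q (snd x)) ` set (a (fst x))" for i x
    by (simp add: F_def)
  have s1: "sep 2 (fst x' mod 8) (fst y' mod 8) (snd x' - snd y') all_dirs"
    if "x' \<in> set (butlast xs)" "y' \<in> set ys" for x' y'
    using ok that by (simp add: links_lift_def Let_def every_iff xs_def ys_def)
  have s2: "sep 2 (fst x mod 8) (fst y' mod 8) (snd x - snd y') all_dirs" if "y' \<in> set (tl ys)" for y'
    using ok that by (simp add: links_lift_def Let_def every_iff xs_def ys_def x_def)
  have mem: "v \<in> set (concat (map (F i) zs)) \<longleftrightarrow>
      (\<exists>z \<in> set zs. \<exists>v0 \<in> set (a (fst z)). v = v0 + value_of p q (snd z))" for v i zs
    by (auto simp: setF)
  have cy: "F (i + 1) y @ concat (map (F (i + 1)) (tl ys)) = concat (map (F (i + 1)) ys)"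
    using ys by (metis concat.simps(2) list.simps(9))
  show ?thesis unfolding bi bj
  proof (rule joined_append)
    have j: "(fst x - 2 - fst y) mod 8 = 0"
      and m: "if reversing t i then snd x - snd y = mv (fst x + 4) else snd y - snd x = mv (fst x + 1)"
      using ok by (simp_all add: links_lift_def Let_def x_def y_def xs_def ys_def)
    show "joined adj (F i x) (F (i + 1) y)"
    proof (cases "reversing t i")
      case True
      then show ?thesis using link_reversed[OF _ j, of "value_of p q (snd x)" "value_of p q (snd y)"] m
        by (simp add: F_def reversing_next flip: value_of_diff)
    next
      case False
      then show ?thesis using link_forward[OF _ j, of "value_of p q (snd y)" "value_of p q (snd x)"] m
        by (simp add: F_def reversing_next flip: value_of_diff)
    qed
    show "F i x \<noteq> []" "F (i + 1) y \<noteq> []" using nonempty by (simp_all add: F_def)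
    show "separated adj (concat (map (F i) (butlast xs))) (F (i + 1) y @ concat (map (F (i + 1)) (tl ys)))"
      unfolding separated_def cy
    proof (intro ballI)
      fix v w assume "v \<in> set (concat (map (F i) (butlast xs)))" "w \<in> set (concat (map (F (i + 1)) ys))"
      then show "v \<noteq> w \<and> \<not> adj v w" unfolding mem using sep_separated[OF s1] by blast
    qed
    show "separated adj (F i x) (concat (map (F (i + 1)) (tl ys)))"
      unfolding separated_def
    proof (intro ballI)
      fix v w assume "v \<in> set (F i x)" "w \<in> set (concat (map (F (i + 1)) (tl ys)))"
      then show "v \<noteq> w \<and> \<not> adj v w" unfolding mem setF using sep_separated[OF s2] by blast
    qed
  qed
qed

text \<open>The four or eight pieces on both sides agree up to the translation identity for \<open>a\<close>.\<close>
lemma b_turn: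
  "map (\<lambda>v. v + value_of p' q' (mv 0)) (b (0 + 4) @ b (0 + 5)) = rev (b 0 @ b (0 + 1))"
  "map (\<lambda>v. v + value_of p' q' (mv 1)) (b (1 + 4) @ b (1 + 5)) = rev (b 1 @ b (1 + 1))"
proof -
  have norm: "a 8 = a 0" "a 9 = a 1" "a 10 = a 2" "a 11 = a 3" "a 12 = a 4" "a (- 1) = a 7"
    by (rule a_cong, simp)+
  have sh: "map (\<lambda>x. x + d) (shift c xs) = shift (c + d) xs" "rev (shift c xs) = shift c (rev xs)"
    "translate xs c = shift c xs" "shift c (xs @ ys) = shift c xs @ shift c ys" for c d xs ys
    by (simp_all add: shift_def translate_def rev_map algebra_simps)
  have st: "shift c (rev (a 1)) @ shift c (rev (a 0)) @ ys =
      shift (c + value_of p q (mv 0)) (a 4) @ shift (c + value_of p q (mv 0)) (a 5) @ ys"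
    "shift c (rev (a 2)) @ shift c (rev (a 1)) @ ys =
      shift (c + value_of p q (mv 1)) (a 5) @ shift (c + value_of p q (mv 1)) (a 6) @ ys"
    "shift c (rev (a 3)) @ shift c (rev (a 2)) @ ys =
      shift (c + value_of p q (mv 2)) (a 6) @ shift (c + value_of p q (mv 2)) (a 7) @ ys"
    "shift c (rev (a 4)) @ shift c (rev (a 3)) @ ys =
      shift (c + value_of p q (mv 3)) (a 7) @ shift (c + value_of p q (mv 3)) (a 0) @ ys"
    "shift c (rev (a 7)) @ shift c (rev (a 6)) @ ys =
      shift (c + value_of p q (mv 6)) (a 2) @ shift (c + value_of p q (mv 6)) (a 3) @ ys"
    "shift c (rev (a 0)) @ shift c (rev (a 7)) @ ys =
      shift (c + value_of p q (mv 7)) (a 3) @ shift (c + value_of p q (mv 7)) (a 4) @ ys" for c ys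
    using shift_turn[of c 0 ys] shift_turn[of c 1 ys] shift_turn[of c 2 ys] shift_turn[of c 3 ys]
      shift_turn[of c 6 ys] shift_turn[of c 7 ys] by (simp_all add: norm)
  note coord = value_of_def scale_def mv_def udir_def P
  have par: "t = Tf \<Longrightarrow> p' = p \<and> q' = 2 * p + q" "t = Tg \<Longrightarrow> p' = q \<and> q' = 2 * q - p"
    "t = Th \<Longrightarrow> p' = q \<and> q' = p + 2 * q" "t = Thbar \<Longrightarrow> p' = q \<and> q' = p + 2 * q"
    using params' by auto
  show "map (\<lambda>v. v + value_of p' q' (mv 0)) (b (0 + 4) @ b (0 + 5)) = rev (b 0 @ b (0 + 1))"
  proof (cases t)
    case Tf then show ?thesis using par(1) unfolding b_def unfolding Tf by (simp add: sh norm st(6)) (simp add: coord algebra_simps)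
  next
    case Tg then show ?thesis using par(2) unfolding b_def unfolding Tg by (simp add: sh norm st(2)) (simp add: coord algebra_simps)
  next
    case Th then show ?thesis using par(3) unfolding b_def unfolding Th by (simp add: sh norm st(5)) (simp add: coord algebra_simps)
  next
    case Thbar then show ?thesis using par(4) unfolding b_def unfolding Thbar by (simp add: sh norm st(3)) (simp add: coord algebra_simps)
  qed
  show "map (\<lambda>v. v + value_of p' q' (mv 1)) (b (1 + 4) @ b (1 + 5)) = rev (b 1 @ b (1 + 1))"
  proof (cases t)
    case Tf then show ?thesis using par(1) unfolding b_def unfolding Tf by (simp add: sh norm st(3)) (simp add: coord algebra_simps)
  next
    case Tg then show ?thesis using par(2) unfolding b_def unfolding Tg by (simp add: sh norm st(1)) (simp add: coord algebra_simps)
  next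
    case Th then show ?thesis using par(3) unfolding b_def unfolding Th by (simp add: sh norm st(4)) (simp add: coord algebra_simps)
  next
    case Thbar then show ?thesis using par(4) unfolding b_def unfolding Thbar by (simp add: sh norm st(6)) (simp add: coord algebra_simps)
  qed
qed

lemma b_params: "0 < p'" "p' < q'"
  using params params' by (cases t; auto)+

lemma b_invariant:
  assumes "cones_lift t 0" "cones_lift t 1" "every (moves_lift t 0) all_dirs" "every (moves_lift t 1) all_dirs"
  shows "lift_invariant b p' q'"
proof (rule lift_invariantI)
  show "map (\<lambda>v. v + value_of p' q' (mv k)) (b (k + 4) @ b (k + 5)) = rev (b k @ b (k + 1))"
    if "k = 0 \<or> k = 1" for k using that b_turn by blast
  show "2 * dot k v + dot k \<mu> < fst f * p' + snd f * q'"
    if "i = 0 \<or> i = 1" "k \<in> set all_dirs" "v \<in> set (b i)" "\<mu> \<in> near" "f \<in> set (bounds i k)" for i k v \<mu> f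
    using that b_bounded bounds_lift by blast
  show "apart b p' q' i (i + d) (fst c) (snd c)" if "i = 0 \<or> i = 1" "c \<in> set (cones i d)" for i d c
    using that b_cones assms(1,2) by blast
  show "apart b p' q' i j (mv k) all_dirs"
    if "k = 0 \<or> k = 1" "i \<in> set all_dirs" "j \<in> set all_dirs" "(i - k) mod 8 \<notin> {4, 5}" "(j - k) mod 8 \<notin> {0, 1}"
    for i j k using that b_moves assms(3,4) unfolding every_iff by blast
  show "joined adj (b i) (b (i + 1))" if "i = 0 \<or> i = 1" for i using that b_join links_lift by blast
qed (rule b_params b_nonempty b_rotate b_path)+

end

lemma cones_lift: "cones_lift t 0" "cones_lift t 1"
  by (induct t; code_simp)+

lemma moves_lift: "every (moves_lift t 0) all_dirs" "every (moves_lift t 1) all_dirs"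
  by (induct t; code_simp)+

section \<open>The octagon\<close>

text \<open>The moves of the \<open>(r, s)\<close>-leaper. The signs of \<open>r\<close> and \<open>s\<close> are immaterial.\<close>
definition moves_of :: "int \<Rightarrow> int \<Rightarrow> square set" where
  "moves_of r s = {\<mu>. \<exists>k. \<mu> = value_of r s (mv k)}"

lemma ex_mod8: "(\<exists>k::int. P (k mod 8)) \<longleftrightarrow> P 0 \<or> P 1 \<or> P 2 \<or> P 3 \<or> P 4 \<or> P 5 \<or> P 6 \<or> P 7"
proof
  assume "\<exists>k::int. P (k mod 8)"
  then obtain k :: int where "P (k mod 8)" by blast
  then show "P 0 \<or> P 1 \<or> P 2 \<or> P 3 \<or> P 4 \<or> P 5 \<or> P 6 \<or> P 7" by (cases k rule: mod8_cases) auto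
next
  assume *: "P 0 \<or> P 1 \<or> P 2 \<or> P 3 \<or> P 4 \<or> P 5 \<or> P 6 \<or> P 7"
  have "P m \<Longrightarrow> 0 \<le> m \<Longrightarrow> m < 8 \<Longrightarrow> \<exists>k::int. P (k mod 8)" for m :: int
    by (rule exI[of _ m]) simp
  from this[of 0] this[of 1] this[of 2] this[of 3] this[of 4] this[of 5] this[of 6] this[of 7] *
  show "\<exists>k::int. P (k mod 8)" by auto
qed

lemma moves_of_eq:
  "moves_of r s = {(s, r), (r, s), (- r, s), (- s, r), (- s, - r), (- r, - s), (r, - s), (s, - r)}"
proof -
  have "(\<exists>k. \<mu> = value_of r s (mv k)) \<longleftrightarrow> (\<exists>k. \<mu> = value_of r s (mv (k mod 8)))" for \<mu> by simp
  then show ?thesis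
    unfolding moves_of_def ex_mod8[of "\<lambda>k. \<mu> = value_of r s (mv k)" for \<mu>]
    by (auto simp: ex_mod8 value_of_def scale_def mv_def)
qed

lemma moves_of_swap: "moves_of s r = moves_of r s" and moves_of_minus: "moves_of r (- s) = moves_of r s"
  unfolding moves_of_eq by auto

lemma leaper_move_iff: "leaper_move L v w \<longleftrightarrow> w - v \<in> moves_of (L $ 1) (L $ 2)"
proof -
  have "w = v + x \<longleftrightarrow> w - v = x" for x by (auto simp: algebra_simps)
  then show ?thesis unfolding leaper_move_def moves_of_eq by auto
qed

lemma move_set_moves_of: "r \<noteq> 0 \<or> s \<noteq> 0 \<Longrightarrow> move_set (moves_of r s)"
proof
  fix \<mu> assume "\<mu> \<in> moves_of r s"
  then obtain k where "\<mu> = value_of r s (mv k)" by (auto simp: moves_of_def)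
  then have "rot \<mu> = value_of r s (mv (k + 2))" by (simp add: mv_rot value_of_rotf)
  then show "rot \<mu> \<in> moves_of r s" by (auto simp: moves_of_def)
qed (auto simp: moves_of_eq zero_prod_def)

text \<open>The form \<open>c\<^sub>1 p + c\<^sub>2 q\<close> is negative for all \<open>0 < p < q\<close>.\<close>
definition neg :: "square \<Rightarrow> bool" where
  "neg c \<longleftrightarrow> snd c \<le> 0 \<and> fst c + snd c \<le> 0 \<and> c \<noteq> 0"

text \<open>The vertices of the octagon, as forms.\<close>
definition octagon_form :: "int \<Rightarrow> form" where
  "octagon_form i = along (if even i then (-1, 1) else (1, 0)) i"

text \<open>The zero vector and the moves of the \<open>(p, q - 2 p)\<close>-leaper, as forms in \<open>p\<close> and \<open>q\<close>.\<close>
definition near_forms :: "form list" where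
  "near_forms = 0 # map (\<lambda>k. (fst (mv k) - snd (mv k) - snd (mv k), snd (mv k))) all_dirs"

text \<open>The separation statement for two vertices of the octagon. Either one direction separates them for all parameters, or
  two directions \<open>l\<close> and \<open>l'\<close> do so alternatively, because a positive combination of the two products is negative.\<close>
definition octagon_apart :: "int \<Rightarrow> int \<Rightarrow> form \<Rightarrow> int list \<Rightarrow> bool" where
  "octagon_apart i j d L \<longleftrightarrow> every (\<lambda>\<mu>. let e = octagon_form j - octagon_form i - \<mu> - d in
     if some (\<lambda>l. neg (form_dot l e)) L then True
     else some (\<lambda>l. some (\<lambda>l'. neg (form_dot l e + form_dot l e + form_dot l' e)) L) L) near_forms"

text \<open>The parts of the invariant for the octagon.\<close>
definition octagon_cones :: "int \<Rightarrow> bool" where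
  "octagon_cones i \<longleftrightarrow> every (\<lambda>d. every (\<lambda>c. octagon_apart i (i + d) (fst c) (snd c)) (cones i d)) [2, 3, 4]"

definition octagon_moves :: "int \<Rightarrow> bool" where
  "octagon_moves k \<longleftrightarrow> every (\<lambda>i. every (\<lambda>j.
     if (i - k) mod 8 = 4 \<or> (i - k) mod 8 = 5 \<or> (j - k) mod 8 = 0 \<or> (j - k) mod 8 = 1 then True
     else octagon_apart i j (mv k) all_dirs) all_dirs) all_dirs"

definition octagon_bounds :: "int \<Rightarrow> bool" where
  "octagon_bounds i \<longleftrightarrow> every (\<lambda>k. every (\<lambda>\<mu>. every (\<lambda>f.
     neg (form_dot k (octagon_form i) + form_dot k (octagon_form i) + form_dot k \<mu> - f)) (bounds i k)) near_forms) all_dirs"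

lemma octagon_checks:
  "octagon_cones 0" "octagon_cones 1" "octagon_moves 0" "octagon_moves 1" "octagon_bounds 0" "octagon_bounds 1"
  by code_simp+

lemma neg_value: "0 < p \<Longrightarrow> p < q \<Longrightarrow> neg c \<Longrightarrow> p * fst c + q * snd c < 0"
proof -
  assume pq: "0 < p" "p < q" and c: "neg c"
  have eq: "p * fst c + q * snd c = p * (fst c + snd c) + (q - p) * snd c" by (simp add: algebra_simps)
  show ?thesis
  proof (cases "snd c = 0")
    case True
    then have "fst c < 0" using c by (auto simp: neg_def prod_eq_iff)
    then show ?thesis using True pq by (simp add: mult_pos_neg)
  next
    case False
    then have "(q - p) * snd c < 0" using c pq by (intro mult_pos_neg) (auto simp: neg_def)
    moreover have "p * (fst c + snd c) \<le> 0" using c pq by (intro mult_nonneg_nonpos) (auto simp: neg_def)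
    ultimately show ?thesis unfolding eq by linarith
  qed
qed

lemma octagon_invariant:
  assumes pq: "0 < p" "p < q"
  shows "move_set.lift_invariant (moves_of p (q - 2 * p)) (octagon (q - p) p) p q"
proof -
  interpret move_set "moves_of p (q - 2 * p)" using pq by (intro move_set_moves_of) simp
  have oct: "octagon (q - p) p i = [value_of p q (octagon_form i)]" for i
    by (simp add: octagon_def octagon_form_def value_along)
  have mem: "m mod 8 \<in> set all_dirs" for m :: int
    unfolding all_dirs_def by (cases m rule: mod8_cases) simp_all
  have near: "\<exists>x \<in> set near_forms. \<mu> = value_of p q x" if \<mu>: "\<mu> \<in> near" for \<mu>
  proof (cases "\<mu> = 0")
    case True then show ?thesis by (simp add: near_forms_def value_of_0)
  next
    case False
    then have "\<mu> \<in> moves_of p (q - 2 * p)" using \<mu> by (simp add: near_def)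
    then obtain k where k: "\<mu> = value_of p (q - 2 * p) (mv k)" unfolding moves_of_def by blast
    define m where "m = k mod 8"
    have "\<mu> = value_of p (q - 2 * p) (mv m)" by (simp add: k m_def)
    also have "\<dots> = value_of p q (fst (mv m) - snd (mv m) - snd (mv m), snd (mv m))"
      by (simp add: value_of_def scale_def algebra_simps)
    finally show ?thesis using mem[of k] unfolding near_forms_def m_def[symmetric] by auto
  qed
  have apart: "apart (octagon (q - p) p) p q i j d L" if ok: "octagon_apart i j d L" for i j d L
    unfolding apart_def oct
  proof (intro ballI)
    fix v w \<mu> assume v: "v \<in> set [value_of p q (octagon_form i)]" and w: "w \<in> set [value_of p q (octagon_form j)]"
      and "\<mu> \<in> near"
    then obtain x where x: "x \<in> set near_forms" "\<mu> = value_of p q x" using near by blast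
    define e where "e = octagon_form j - octagon_form i - x - d"
    have "if some (\<lambda>l. neg (form_dot l e)) L then True
        else some (\<lambda>l. some (\<lambda>l'. neg (form_dot l e + form_dot l e + form_dot l' e)) L) L"
      using ok x(1) unfolding octagon_apart_def every_iff Let_def e_def by blast
    then have "(\<exists>l \<in> set L. neg (form_dot l e))
        \<or> (\<exists>l \<in> set L. \<exists>l' \<in> set L. neg (form_dot l e + form_dot l e + form_dot l' e))"
      by (auto simp: some_iff split: if_splits)
    then have "\<exists>l \<in> set L. dot l (value_of p q e) < 0"
    proof (elim disjE bexE)
      fix l assume "l \<in> set L" "neg (form_dot l e)"
      then show ?thesis using neg_value[OF pq] by (auto simp: dot_value_of intro!: bexI[of _ l])
    next
      fix l l' assume l: "l \<in> set L" "l' \<in> set L" and n: "neg (form_dot l e + form_dot l e + form_dot l' e)"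
      have "2 * dot l (value_of p q e) + dot l' (value_of p q e) < 0"
        using neg_value[OF pq n] by (simp add: dot_value_of algebra_simps)
      then have "dot l (value_of p q e) < 0 \<or> dot l' (value_of p q e) < 0" by linarith
      then show ?thesis using l by blast
    qed
    moreover have "w - v - \<mu> - value_of p q d = value_of p q e"
      using v w x(2) by (simp add: e_def value_of_diff)
    ultimately show "\<exists>l \<in> set L. dot l (w - v - \<mu> - value_of p q d) < 0" by simp
  qed
  show ?thesis
  proof (rule lift_invariantI)
    show "octagon (q - p) p (i + 2) = map rot (octagon (q - p) p i)" for i
      by (simp add: octagon_def udir_rot rot_scale)
    show "map (\<lambda>v. v + value_of p q (mv k)) (octagon (q - p) p (k + 4) @ octagon (q - p) p (k + 5)) =
      rev (octagon (q - p) p k @ octagon (q - p) p (k + 1))" if "k = 0 \<or> k = 1" for k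
      using that by (auto simp: octagon_def scale_def udir_def value_of_def mv_def)
    show "2 * dot k v + dot k \<mu> < fst f * p + snd f * q"
      if "i = 0 \<or> i = 1" "k \<in> set all_dirs" "v \<in> set (octagon (q - p) p i)" "\<mu> \<in> near" "f \<in> set (bounds i k)"
      for i k v \<mu> f
    proof -
      obtain x where x: "x \<in> set near_forms" "\<mu> = value_of p q x" using near \<open>\<mu> \<in> near\<close> by blast
      have "octagon_bounds i" using that(1) octagon_checks by blast
      then have "neg (form_dot k (octagon_form i) + form_dot k (octagon_form i) + form_dot k x - f)"
        using that(2,5) x(1) by (simp add: octagon_bounds_def every_iff)
      from neg_value[OF pq this] show ?thesis
        using that(3) by (simp add: oct x(2) dot_value_of algebra_simps)
    qed
    show "apart (octagon (q - p) p) p q i (i + d) (fst c) (snd c)"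
      if "i = 0 \<or> i = 1" "c \<in> set (cones i d)" for i d c
    proof -
      have "d \<in> {2, 3, 4}" using that(2) by (auto simp: cones_def split: if_splits)
      moreover have "\<forall>d \<in> {2, 3, 4}. \<forall>c \<in> set (cones i d). octagon_apart i (i + d) (fst c) (snd c)"
        using that(1) octagon_checks(1,2) unfolding octagon_cones_def every_iff by auto
      ultimately show ?thesis using that(2) apart by blast
    qed
    show "apart (octagon (q - p) p) p q i j (mv k) all_dirs"
      if k: "k = 0 \<or> k = 1" and ij: "i \<in> set all_dirs" "j \<in> set all_dirs"
        and "(i - k) mod 8 \<notin> {4, 5}" "(j - k) mod 8 \<notin> {0, 1}" for k i j
    proof -
      have "octagon_moves k" using k octagon_checks by blast
      then have "octagon_apart i j (mv k) all_dirs"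
        using that unfolding octagon_moves_def every_iff by (simp split: if_splits)
      then show ?thesis by (rule apart)
    qed
    show "induced_path adj (octagon (q - p) p i)" for i
      by (simp add: induced_path_def octagon_def adj_def zero_move)
    have "(2 * p - q, p) \<in> moves_of p (q - 2 * p)" "(- p, q - 2 * p) \<in> moves_of p (q - 2 * p)"
      unfolding moves_of_eq by simp_all
    then show "joined adj (octagon (q - p) p i) (octagon (q - p) p (i + 1))" if "i = 0 \<or> i = 1" for i
      using that pq by (auto simp: joined_def octagon_def adj_def scale_def udir_def)
  qed (use pq in \<open>simp_all add: octagon_def\<close>)
qed

section \<open>The two leaper graphs over the board\<close>

text \<open>The squares of a cycle.\<close>
definition board_of :: "path_cycle \<Rightarrow> board" where
  "board_of a = (\<Union>i \<in> {0..<8}. set (a i))"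

context lifted
begin

lemma in_board: "v \<in> board_of a \<longleftrightarrow> (\<exists>i. v \<in> set (a i))"
proof
  assume "\<exists>i. v \<in> set (a i)"
  then obtain i where "v \<in> set (a (i mod 8))" by (auto simp: a_mod)
  moreover have "i mod 8 \<in> {0..<8}" by simp
  ultimately show "v \<in> board_of a" unfolding board_of_def by blast
qed (auto simp: board_of_def)

lemma same_piece:
  assumes "v \<in> set (a i)" "v \<in> set (a j)"
  shows "(i - j) mod 8 = 0"
proof -
  define d where "d = (i - j) mod 8"
  have ai: "a i = a (j + d)" by (rule a_cong) (simp add: d_def mod_diff_right_eq diff_diff_eq[symmetric])
  have z: "v - v \<in> near" by (simp add: near_def)
  have "d \<notin> {2, 3, 4, 5, 6}" using far[of d v j v] z assms ai by auto
  moreover have "d \<noteq> 1" using disjoint_next[of v j] assms ai by auto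
  moreover have "d \<noteq> 7"
  proof
    assume "d = 7"
    then have "a j = a (i + 1)" using ai a_cong[of "j + 7 + 1" j] by (intro a_cong) (simp add: d_def, presburger)
    then show False using disjoint_next[of v i] assms by simp
  qed
  ultimately show ?thesis
    unfolding d_def[symmetric] using mod8_cases[of "i - j" "d = 0"] unfolding d_def by auto
qed

text \<open>A move \<open>m\<^sub>k\<close> within the board is one of those given by the translation identity: by the invariant, either its
  source or its target lies on one of the four paths involved.\<close>
lemma long_move_source:
  assumes v: "v \<in> set (a i)" and w: "v + value_of p q (mv k) \<in> set (a j)"
  shows "(i - k) mod 8 \<in> {4, 5}" "(j - k) mod 8 \<in> {0, 1}"
proof -
  have "0 \<in> near" by (simp add: near_def)
  then have "\<not> apart a p q i j (mv k) all_dirs"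
    using apart_point[of a p q i j "mv k", OF _ v w] by (metis add_diff_cancel_left' diff_self)
  then have or: "(i - k) mod 8 \<in> {4, 5} \<or> (j - k) mod 8 \<in> {0, 1}" using move_apart by blast
  have i: "(i - k) mod 8 \<in> {4, 5}" if "v \<in> set (a (k + 4)) \<or> v \<in> set (a (k + 5))"
    using that same_piece[OF v, of "k + 4"] same_piece[OF v, of "k + 5"] by auto presburger+
  have j: "(j - k) mod 8 \<in> {0, 1}"
    if "v + value_of p q (mv k) \<in> set (a k) \<or> v + value_of p q (mv k) \<in> set (a (k + 1))"
    using that same_piece[OF w, of k] same_piece[OF w, of "k + 1"] by auto presburger+
  have "v \<in> set (a (k + 4)) \<or> v \<in> set (a (k + 5))"
    using or
  proof
    assume "(i - k) mod 8 \<in> {4, 5}"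
    then have "(i - (k + 4)) mod 8 = 0 \<or> (i - (k + 5)) mod 8 = 0" by auto presburger+
    then show ?thesis using v a_cong[of i "k + 4"] a_cong[of i "k + 5"] by auto
  next
    assume "(j - k) mod 8 \<in> {0, 1}"
    then have "(j - k) mod 8 = 0 \<or> (j - (k + 1)) mod 8 = 0" by auto presburger
    then have "v + value_of p q (mv k) \<in> set (a k) \<or> v + value_of p q (mv k) \<in> set (a (k + 1))"
      using w a_cong[of j k] a_cong[of j "k + 1"] by auto
    then show ?thesis by (simp add: turn_set)
  qed
  then show "(i - k) mod 8 \<in> {4, 5}" "(j - k) mod 8 \<in> {0, 1}" using i j turn_set by blast+
qed

lemma mv_distinct: "value_of p q (mv k) \<noteq> value_of p q (mv (k + 1))"
  unfolding mv_def[of k] mv_def[of "k + 1"] mod_add_cases[of k] using params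
  by (cases k rule: mod8_cases) (simp_all add: value_of_def scale_def)

lemma long_neighbours:
  assumes v: "v \<in> set (a i)"
  shows "{w \<in> board_of a. w - v \<in> moves_of p q} = {v + value_of p q (mv (i + 3)), v + value_of p q (mv (i + 4))}"
proof (intro equalityI subsetI)
  fix w assume "w \<in> {w \<in> board_of a. w - v \<in> moves_of p q}"
  then obtain j k where "w \<in> set (a j)" "w = v + value_of p q (mv k)"
    by (auto simp: in_board moves_of_def algebra_simps)
  then have "(i - k) mod 8 \<in> {4, 5}" using long_move_source[OF v] by blast
  then have "(k - (i + 4)) mod 8 = 0 \<or> (k - (i + 3)) mod 8 = 0" by auto presburger+
  then have "mv k = mv (i + 4) \<or> mv k = mv (i + 3)"
    by (metis mv_mod mod_eq_dvd_iff dvd_eq_mod_eq_0)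
  then show "w \<in> {v + value_of p q (mv (i + 3)), v + value_of p q (mv (i + 4))}"
    using \<open>w = v + value_of p q (mv k)\<close> by auto
next
  have "v \<in> set (a (i + 4 + 4))" "v \<in> set (a (i + 3 + 5))" using v period[of i] by (simp_all add: add.assoc)
  then have "v + value_of p q (mv (i + 4)) \<in> board_of a" "v + value_of p q (mv (i + 3)) \<in> board_of a"
    unfolding in_board using turn_set by blast+
  moreover fix w assume "w \<in> {v + value_of p q (mv (i + 3)), v + value_of p q (mv (i + 4))}"
  ultimately show "w \<in> {w \<in> board_of a. w - v \<in> moves_of p q}" by (auto simp: moves_of_def)
qed

text \<open>The paths \<open>a\<^sub>0, \<dots>, a\<^sub>6\<close> form an induced path of \<open>M\<close>, which \<open>a\<^sub>7\<close> closes to a cycle.\<close>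
lemma short_cyclic: "cyclic_list adj ((a 0 @ a 1 @ a 2 @ a 3 @ a 4 @ a 5 @ a 6) @ a 7)"
proof -
  have sep: "separated adj us (vs @ ws)" "separated adj (us @ vs) ws = (separated adj us ws \<and> separated adj vs ws)"
    if "separated adj us vs" "separated adj us ws" for us vs ws
    using that by (auto simp: separated_def)
  have p0: "induced_path adj (a 0 @ a 1 @ a 2 @ a 3 @ a 4)" using arc5[of 0] by simp
  have "joined adj (a 5) (a 6)" "joined adj (a 4) (a 5)" by (simp_all add: join_at)
  then have p1: "induced_path adj (a 5 @ a 6)" by (intro induced_path_append) (simp_all add: adj_sym path nonempty)
  have "joined adj ((a 0 @ a 1 @ a 2 @ a 3) @ a 4) (a 5 @ a 6)"
    by (rule joined_append) (use nonempty separated_at[of 5 0] separated_at[of 5 1] separated_at[of 5 2]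
      separated_at[of 5 3] separated_at[of 6 0] separated_at[of 6 1] separated_at[of 6 2] separated_at[of 6 3]
      separated_at[of 6 4] \<open>joined adj (a 4) (a 5)\<close> in \<open>auto simp: separated_def\<close>)
  then have j: "joined adj (a 0 @ a 1 @ a 2 @ a 3 @ a 4) (a 5 @ a 6)" by simp
  have p: "induced_path adj (a 0 @ a 1 @ a 2 @ a 3 @ a 4 @ a 5 @ a 6)"
    using induced_path_append[OF adj_sym p0 _ p1 _ j] nonempty by simp
  show ?thesis
  proof (rule cyclic_list_append[OF adj_sym p _ path nonempty])
    show "3 \<le> length (a 0 @ a 1 @ a 2 @ a 3 @ a 4 @ a 5 @ a 6) + length (a 7)"
      using nonempty[of 0] nonempty[of 1] nonempty[of 2] by (simp add: Suc_le_eq[symmetric] flip: length_greater_0_conv)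
    fix x y assume x: "x \<in> set (a 0 @ a 1 @ a 2 @ a 3 @ a 4 @ a 5 @ a 6)" and y: "y \<in> set (a 7)"
    have l: "last (a 0 @ a 1 @ a 2 @ a 3 @ a 4 @ a 5 @ a 6) = last (a 6)"
      and h: "hd (a 0 @ a 1 @ a 2 @ a 3 @ a 4 @ a 5 @ a 6) = hd (a 0)" using nonempty by simp_all
    have ends: "hd (a 0) \<in> set (a 0)" "last (a 6) \<in> set (a 6)" using nonempty by simp_all
    obtain i where i: "i \<in> {0, 1, 2, 3, 4, 5, 6}" "x \<in> set (a i)" using x by auto
    have x0: "x = hd (a 0) \<Longrightarrow> i = 0" using same_piece[OF i(2), of 0] ends i(1) by auto
    have x6: "x = last (a 6) \<Longrightarrow> i = 6" using same_piece[OF i(2), of 6] ends i(1) by auto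
    consider "i = 0" | "i = 6" | "7 - i \<in> {2, 3, 4, 5, 6}" using i(1) by auto
    then show "x \<noteq> y \<and> (adj x y \<longleftrightarrow> x = last (a 0 @ a 1 @ a 2 @ a 3 @ a 4 @ a 5 @ a 6) \<and> y = hd (a 7) \<or>
      x = hd (a 0 @ a 1 @ a 2 @ a 3 @ a 4 @ a 5 @ a 6) \<and> y = last (a 7))"
      unfolding l h
    proof cases
      case 1
      have "joined adj (a 7) (a 0)" using join[of 7] a_cong[of 8 0] by simp
      then have "y \<noteq> x \<and> (adj y x \<longleftrightarrow> y = last (a 7) \<and> x = hd (a 0))" using i 1 y by (auto simp: joined_def)
      then show "x \<noteq> y \<and> (adj x y \<longleftrightarrow> x = last (a 6) \<and> y = hd (a 7) \<or> x = hd (a 0) \<and> y = last (a 7))"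
        using x6 1 adj_sym[of x y] by auto
    next
      case 2
      have "joined adj (a 6) (a 7)" by (simp add: join_at)
      then have "x \<noteq> y \<and> (adj x y \<longleftrightarrow> x = last (a 6) \<and> y = hd (a 7))" using i 2 y by (auto simp: joined_def)
      then show "x \<noteq> y \<and> (adj x y \<longleftrightarrow> x = last (a 6) \<and> y = hd (a 7) \<or> x = hd (a 0) \<and> y = last (a 7))"
        using x0 2 by auto
    next
      case 3
      then have "x \<noteq> y \<and> \<not> adj x y" using separated_at[of 7 i] i y by (auto simp: separated_def)
      then show "x \<noteq> y \<and> (adj x y \<longleftrightarrow> x = last (a 6) \<and> y = hd (a 7) \<or> x = hd (a 0) \<and> y = last (a 7))"
        using x0 x6 3 by auto
    qed
  qed (use nonempty in simp)
qed

end

section \<open>Connectedness under lifting\<close>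

text \<open>The graph of the \<open>(r, s)\<close>-leaper over \<open>B\<close>, as a relation.\<close>
definition move_graph :: "int \<Rightarrow> int \<Rightarrow> board \<Rightarrow> square rel" where
  "move_graph r s B = {(v, w). v \<in> B \<and> w \<in> B \<and> w - v \<in> moves_of r s}"

text \<open>The translations under which \<open>a j\<close> occurs in the lift of type \<open>t\<close>, in such an order that
  consecutive ones differ by a move of the new leaper.\<close>
fun copies :: "type_char \<Rightarrow> int \<Rightarrow> form list" where
  "copies Tf j = (if even j then [along (1, 1) (j + 4)]
     else [along (1, 1) (j + 3), along (1, 0) j, along (1, 1) (j + 5)])"
| "copies Tg j = (if odd j then [along (0, 1) (j + 4)]
     else [along (0, 1) (j + 3), along (-1, 1) j, along (0, 1) (j + 5)])"
| "copies Th j = (if odd j then [along (1, 1) (j + 3), along (0, 1) j, along (1, 1) (j + 5)]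
     else [along (1, 1) (j + 6), along (0, 1) (j + 1), along (1, 1) (j + 4), along (0, 1) (j + 7), along (1, 1) (j + 2)])"
| "copies Thbar j = (if even j then [along (0, 1) (j + 3), along (1, 1) j, along (0, 1) (j + 5)]
     else [along (0, 1) (j + 6), along (1, 1) (j + 1), along (0, 1) (j + 4), along (1, 1) (j + 7), along (0, 1) (j + 2)])"

text \<open>The form \<open>d\<close> is a move of the new leaper, expressed in the old parameters.\<close>
definition lifted_move :: "type_char \<Rightarrow> form \<Rightarrow> bool" where
  "lifted_move t d \<longleftrightarrow> some (\<lambda>k. subst t (mv k) = d) all_dirs"

text \<open>The translations \<open>copies t\<close> are exactly those that occur in \<open>pieces t\<close>, they are linked by moves of the new leaper,
  and so are, for each move \<open>m\<^sub>k\<close> from \<open>a j\<close> to \<open>a j'\<close>, a translate of the source and a translate of the target.\<close>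
definition copies_ok :: "type_char \<Rightarrow> bool" where
  "copies_ok t \<longleftrightarrow>
     every (\<lambda>i. every (\<lambda>x. some (\<lambda>s. s = snd x) (copies t (fst x mod 8))) (pieces t i)) all_dirs
   \<and> every (\<lambda>j. every (\<lambda>s. some (\<lambda>i. some (\<lambda>x. fst x mod 8 = j \<and> snd x = s) (pieces t i)) all_dirs) (copies t j)) all_dirs
   \<and> every (\<lambda>j. successively (\<lambda>s s'. lifted_move t (s' - s)) (copies t j)) all_dirs
   \<and> every (\<lambda>k. every (\<lambda>j. every (\<lambda>j'. some (\<lambda>s. some (\<lambda>s'. lifted_move t (mv k + s' - s))
       (copies t (j' mod 8))) (copies t (j mod 8))) [k, k + 1]) [k + 4, k + 5]) all_dirs"

lemma copies_ok: "copies_ok t" by (induct t) code_simp+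

lemma moves_of_minus_iff: "- \<mu> \<in> moves_of r s \<longleftrightarrow> \<mu> \<in> moves_of r s"
  unfolding moves_of_eq by (cases \<mu>) (auto simp: minus_equation_iff[of _ r] minus_equation_iff[of _ s])

lemma sym_move_graph: "sym (move_graph r s B)"
  using moves_of_minus_iff by (fastforce simp: sym_def move_graph_def)

lemma successively_rtrancl:
  assumes "successively (\<lambda>x y. (f x, f y) \<in> R) xs" "sym R" "x \<in> set xs" "y \<in> set xs"
  shows "(f x, f y) \<in> R\<^sup>*"
proof -
  have hd: "(f z, f y) \<in> R\<^sup>*" if "successively (\<lambda>x y. (f x, f y) \<in> R) (z # zs)" "y \<in> set (z # zs)" for z zs y
    using that
  proof (induction zs arbitrary: z)
    case (Cons u zs)
    then show ?case by (auto intro: converse_rtrancl_into_rtrancl)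
  qed simp
  obtain z zs where xs: "xs = z # zs" using assms(3) by (cases xs) auto
  have "(f z, f x) \<in> R\<^sup>*" "(f z, f y) \<in> R\<^sup>*" using hd assms xs by blast+
  moreover have "sym (R\<^sup>*)" using assms(2) by (rule sym_rtrancl)
  ultimately show ?thesis by (meson rtrancl_trans symD)
qed

context lifting_step
begin

lemma lifted_move: "lifted_move t d \<Longrightarrow> value_of p q d \<in> moves_of p' q'"
  by (auto simp: lifted_move_def some_iff moves_of_def value_subst)

lemma b_connected:
  assumes con: "\<And>v w. v \<in> board_of a \<Longrightarrow> w \<in> board_of a \<Longrightarrow> (v, w) \<in> (move_graph p q (board_of a))\<^sup>*"
    and v: "v \<in> board_of b" and w: "w \<in> board_of b"
  shows "(v, w) \<in> (move_graph p' q' (board_of b))\<^sup>*"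
proof -
  let ?G = "move_graph p q (board_of a)" and ?H = "move_graph p' q' (board_of b)"
  have dirs: "set all_dirs = {0..<8}" by (auto simp: all_dirs_def)
  have origin: "\<exists>j x s. j \<in> set all_dirs \<and> x \<in> set (a j) \<and> s \<in> set (copies t j) \<and> u = x + value_of p q s"
    if u: "u \<in> board_of b" for u
  proof -
    obtain i where i: "i \<in> set all_dirs" "u \<in> set (b i)" using u by (auto simp: board_of_def dirs)
    then obtain y x where y: "y \<in> set (pieces t i)" "x \<in> set (a (fst y mod 8))" "u = x + value_of p q (snd y)"
      unfolding set_b by (auto simp: a_mod)
    moreover have "snd y \<in> set (copies t (fst y mod 8))"
      using copies_ok[of t] i y by (auto simp: copies_ok_def every_iff some_iff)
    moreover have "fst y mod 8 \<in> set all_dirs" by (simp add: dirs)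
    ultimately show ?thesis by blast
  qed
  have copy: "x + value_of p q s \<in> board_of b"
    if "j \<in> set all_dirs" "x \<in> set (a j)" "s \<in> set (copies t j)" for j x s
  proof -
    have "\<exists>i \<in> set all_dirs. \<exists>y \<in> set (pieces t i). fst y mod 8 = j \<and> snd y = s"
      using copies_ok[of t] that by (auto simp: copies_ok_def every_iff some_iff)
    then obtain i y where i: "i \<in> set all_dirs" "y \<in> set (pieces t i)" "fst y mod 8 = j" "snd y = s" by blast
    then have "x \<in> set (a (fst y))" using that(2) a_mod[of "fst y"] by simp
    then have "x + value_of p q s \<in> set (b i)" unfolding set_b using i by blast
    then show ?thesis using i(1) by (auto simp: board_of_def dirs)
  qed
  have chain: "(x + value_of p q s, x + value_of p q s') \<in> ?H\<^sup>*"
    if j: "j \<in> set all_dirs" and x: "x \<in> set (a j)" and s: "s \<in> set (copies t j)" "s' \<in> set (copies t j)" for j x s s'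
  proof (rule successively_rtrancl[where f = "\<lambda>s. x + value_of p q s", OF _ sym_move_graph s])
    have "successively (\<lambda>s s'. lifted_move t (s' - s)) (copies t j)"
      using copies_ok[of t] j by (auto simp: copies_ok_def every_iff)
    then show "successively (\<lambda>s s'. (x + value_of p q s, x + value_of p q s') \<in> ?H) (copies t j)"
    proof (rule successively_mono)
      fix s s' assume "s \<in> set (copies t j)" "s' \<in> set (copies t j)" "lifted_move t (s' - s)"
      then show "(x + value_of p q s, x + value_of p q s') \<in> ?H"
        using copy[OF j x] lifted_move[of "s' - s"] by (simp add: move_graph_def value_of_diff)
    qed
  qed
  obtain jv xv sv where v': "jv \<in> set all_dirs" "xv \<in> set (a jv)" "sv \<in> set (copies t jv)" "v = xv + value_of p q sv"
    using origin[OF v] by blast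
  obtain jw xw sw where w': "jw \<in> set all_dirs" "xw \<in> set (a jw)" "sw \<in> set (copies t jw)" "w = xw + value_of p q sw"
    using origin[OF w] by blast
  have same: "i = j" if "x \<in> set (a i)" "x \<in> set (a j)" "i \<in> set all_dirs" "j \<in> set all_dirs" for x i j
    using same_piece[OF that(1,2)] that(3,4) by (auto simp: all_dirs_def)
  have "xv \<in> board_of a" "xw \<in> board_of a" using v'(2) w'(2) in_board by blast+
  then have "(xv, xw) \<in> ?G\<^sup>*" by (rule con)
  \<comment> \<open>Induction along the path from \<open>xv\<close> to \<open>xw\<close>: all copies of the current square are reached.\<close>
  then have "\<forall>j s. j \<in> set all_dirs \<longrightarrow> xw \<in> set (a j) \<longrightarrow> s \<in> set (copies t j) \<longrightarrow> (v, xw + value_of p q s) \<in> ?H\<^sup>*"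
  proof (induction rule: rtrancl_induct)
    case base
    show ?case
    proof (intro allI impI)
      fix j s assume j: "j \<in> set all_dirs" "xv \<in> set (a j)" "s \<in> set (copies t j)"
      then have "j = jv" using same v' by blast
      then show "(v, xv + value_of p q s) \<in> ?H\<^sup>*" using chain[OF v'(1,2,3), of s] j v'(4) by simp
    qed
  next
    case (step y z)
    show ?case
    proof (intro allI impI)
      fix j s assume j: "j \<in> set all_dirs" and z: "z \<in> set (a j)" and s: "s \<in> set (copies t j)"
      have "y \<in> board_of a" and "z - y \<in> moves_of p q" using step.hyps(2) by (auto simp: move_graph_def)
      then obtain i k0 where i: "y \<in> set (a (i mod 8))" and k0: "z - y = value_of p q (mv k0)"
        by (auto simp: in_board moves_of_def a_mod)
      define k where "k = k0 mod 8"
      have k: "k \<in> set all_dirs" by (simp add: k_def dirs)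
      have zy: "z = y + value_of p q (mv k)" using k0 by (simp add: k_def algebra_simps)
      have im: "i mod 8 \<in> set all_dirs" by (simp add: dirs)
      have "(i mod 8 - k) mod 8 \<in> {4, 5}" "(j - k) mod 8 \<in> {0, 1}"
        using long_move_source[OF i, of k j] z zy by simp_all
      then have "(i - (k + 4)) mod 8 = 0 \<or> (i - (k + 5)) mod 8 = 0" "(j - k) mod 8 = 0 \<or> (j - (k + 1)) mod 8 = 0"
        by auto presburger+
      then have "\<exists>i' \<in> set [k + 4, k + 5]. i' mod 8 = i mod 8" "\<exists>j' \<in> set [k, k + 1]. j' mod 8 = j mod 8"
        by (simp_all add: mod_eq_dvd_iff mod_eq_0_iff_dvd dvd_diff_commute)
      moreover have "j mod 8 = j" using j by (simp add: dirs)
      ultimately have "\<exists>i' \<in> set [k + 4, k + 5]. i' mod 8 = i mod 8" "\<exists>j' \<in> set [k, k + 1]. j' mod 8 = j"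
        by simp_all
      then obtain i' j' where i': "i' \<in> set [k + 4, k + 5]" "i' mod 8 = i mod 8"
        and j': "j' \<in> set [k, k + 1]" "j' mod 8 = j" by blast
      have "\<exists>s \<in> set (copies t (i' mod 8)). \<exists>s' \<in> set (copies t (j' mod 8)). lifted_move t (mv k + s' - s)"
        using copies_ok[of t] k i'(1) j'(1) unfolding copies_ok_def every_iff some_iff by blast
      then obtain s1 s2 where s1: "s1 \<in> set (copies t (i mod 8))" and s2: "s2 \<in> set (copies t j)"
        and m: "lifted_move t (mv k + s2 - s1)" using i' j' by auto
      have "(v, y + value_of p q s1) \<in> ?H\<^sup>*" using step.IH im i s1 by blast
      also have "(y + value_of p q s1, z + value_of p q s2) \<in> ?H"
        using lifted_move[OF m] copy[OF im i s1] copy[OF j z s2]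
        by (simp add: move_graph_def zy value_of_add value_of_diff algebra_simps)
      also have "(z + value_of p q s2, z + value_of p q s) \<in> ?H\<^sup>*" by (rule chain[OF j z s2 s])
      finally show "(v, z + value_of p q s) \<in> ?H\<^sup>*" .
    qed
  qed
  then show ?thesis using w' by blast
qed

end

lemma octagon_connected:
  assumes pq: "0 < p" "p < q" and v: "v \<in> board_of (octagon (q - p) p)" and w: "w \<in> board_of (octagon (q - p) p)"
  shows "(v, w) \<in> (move_graph p q (board_of (octagon (q - p) p)))\<^sup>*"
proof -
  let ?B = "board_of (octagon (q - p) p)"
  define f where "f i = hd (octagon (q - p) p i)" for i
  have f: "octagon (q - p) p i = [f i]" for i by (simp add: f_def octagon_def)
  have B: "?B = f ` {0..<8}" by (auto simp: board_of_def f)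
  \<comment> \<open>The long moves visit the vertices of the octagon in steps of three.\<close>
  have eight: "{0..<8::int} = {0, 3, 6, 1, 4, 7, 2, 5}" by auto
  have "successively (\<lambda>i j. (f i, f j) \<in> move_graph p q ?B) [0, 3, 6, 1, 4, 7, 2, 5]"
    unfolding B eight by (simp add: move_graph_def moves_of_eq f_def octagon_def scale_def udir_def)
  then have "(f i, f j) \<in> (move_graph p q ?B)\<^sup>*" if "i \<in> {0..<8}" "j \<in> {0..<8}" for i j
    by (rule successively_rtrancl[OF _ sym_move_graph]) (use that in \<open>simp_all only: eight list.set\<close>)
  then show ?thesis using v w unfolding B by blast
qed

section \<open>Duality\<close>

lemma cyclic_lists_iso:
  fixes G H :: "'a pair_pre_digraph"
  assumes xs: "cyclic_list R xs" and ys: "cyclic_list S ys" and len: "length xs = length ys"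
    and G: "G = \<lparr> pverts = set xs, parcs = {(x, y). x \<in> set xs \<and> y \<in> set xs \<and> R x y} \<rparr>"
    and H: "H = \<lparr> pverts = set ys, parcs = {(x, y). x \<in> set ys \<and> y \<in> set ys \<and> S x y} \<rparr>"
  shows "digraph_iso (with_proj G) (with_proj H)"
proof -
  define n where "n = length xs"
  \<comment> \<open>The isomorphism preserves the positions in the two lists.\<close>
  define pos where "pos x = (THE i. i < n \<and> xs ! i = x)" for x
  define f where "f x = ys ! pos x" for x
  have dx: "distinct xs" and dy: "distinct ys" using xs ys by (simp_all add: cyclic_list_def)
  have pos: "pos (xs ! i) = i" if "i < n" for i
    unfolding pos_def using dx that by (intro the_equality) (auto simp: n_def nth_eq_iff_index_eq)
  have f: "f (xs ! i) = ys ! i" if "i < n" for i using pos that by (simp add: f_def)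
  have ix: "set xs = (!) xs ` {..<n}" and iy: "set ys = (!) ys ` {..<n}"
    using len by (auto simp: set_conv_nth n_def)
  have inj: "inj_on f (set xs)"
    unfolding ix using dy len by (auto simp: inj_on_def f n_def nth_eq_iff_index_eq)
  have RS: "R (xs ! i) (xs ! j) \<longleftrightarrow> S (ys ! i) (ys ! j)" if "i < n" "j < n" for i j
    using xs ys that len by (simp add: cyclic_list_def n_def)
  have fv: "f ` set xs = set ys" unfolding ix iy by (force simp: f)
  define g where "g e = (f (fst e), f (snd e))" for e
  have ga: "g ` parcs G = parcs H"
  proof (intro equalityI subsetI)
    fix e assume "e \<in> g ` parcs G"
    then obtain i j where "i < n" "j < n" "R (xs ! i) (xs ! j)" "e = (f (xs ! i), f (xs ! j))"
      by (auto simp: G g_def ix)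
    then show "e \<in> parcs H" using RS by (auto simp: H iy f)
  next
    fix e assume "e \<in> parcs H"
    then obtain i j where ij: "i < n" "j < n" "S (ys ! i) (ys ! j)" "e = (ys ! i, ys ! j)"
      by (auto simp: H iy)
    then have "(xs ! i, xs ! j) \<in> parcs G" "e = g (xs ! i, xs ! j)" using RS by (auto simp: G ix f g_def)
    then show "e \<in> g ` parcs G" by blast
  qed
  let ?h = "\<lparr> iso_verts = f, iso_arcs = g, iso_head = snd, iso_tail = fst \<rparr>"
  have "wf_digraph (with_proj G)" by unfold_locales (auto simp: G)
  moreover have "inj_on g (parcs G)"
    using inj by (auto simp: inj_on_def g_def G)
  ultimately have "pre_digraph.digraph_isomorphism (with_proj G) ?h"
    using inj by (auto simp: pre_digraph.digraph_isomorphism_def g_def G)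
  moreover have "with_proj H = app_iso ?h (with_proj G)"
    using fv ga by (simp add: app_iso_def with_proj_def G H)
  ultimately show ?thesis unfolding digraph_iso_def by blast
qed

lemma connected_leaper_graph:
  assumes ne: "B \<noteq> {}"
    and con: "\<And>v w. v \<in> B \<Longrightarrow> w \<in> B \<Longrightarrow> (v, w) \<in> {(v, w). v \<in> B \<and> w \<in> B \<and> leaper_move L v w}\<^sup>*"
  shows "Digraph_Component.connected (with_proj (leaper_graph L B))"
proof -
  let ?R = "{(v, w). v \<in> B \<and> w \<in> B \<and> leaper_move L v w}"
  have "- x \<in> moves_of r s" if "x \<in> moves_of r s" for x r s using that by (simp add: moves_of_minus_iff)
  then have "leaper_move L w v" if "leaper_move L v w" for v w
    using that unfolding leaper_move_iff by (metis minus_diff_eq)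
  then have "sym ?R" by (auto simp: sym_def)
  then have ends: "arcs_ends (mk_symmetric (with_proj (leaper_graph L B))) = ?R"
    by (auto simp: mk_symmetric_def leaper_graph_def sym_def)
  have verts: "verts (mk_symmetric (with_proj (leaper_graph L B))) = B"
    by (simp add: mk_symmetric_def leaper_graph_def)
  have "(v, w) \<in> rtrancl_on B ?R" if "v \<in> B" "w \<in> B" for v w
    using con[OF that] by (induction rule: rtrancl_induct) (use that in \<open>auto intro: rtrancl_on_into_rtrancl_on\<close>)
  then show ?thesis
    unfolding Digraph_Component.connected_def strongly_connected_def reachable_def ends verts using ne by blast
qed

lemma cyclic_list_connected:
  assumes c: "cyclic_list R xs" and "x \<in> set xs" "y \<in> set xs" and sym: "\<And>x y. R x y \<Longrightarrow> R y x"
  shows "(x, y) \<in> {(x, y). x \<in> set xs \<and> y \<in> set xs \<and> R x y}\<^sup>*"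
proof -
  let ?R = "{(x, y). x \<in> set xs \<and> y \<in> set xs \<and> R x y}"
  have "R (xs ! i) (xs ! Suc i)" if "Suc i < length xs" for i
    using c that unfolding cyclic_list_def by (metis Suc_lessD mod_less)
  then have "successively (\<lambda>x y. (x, y) \<in> ?R) xs"
    by (auto simp: successively_conv_nth)
  moreover have "sym ?R" using sym by (auto simp: sym_def)
  ultimately show ?thesis using successively_rtrancl[of "\<lambda>x. x"] assms(2,3) by fastforce
qed

lemma (in lifted) dual_board:
  assumes Mv: "Mv = moves_of (M $ 1) (M $ 2)" and L: "L $ 1 = p" "L $ 2 = q"
    and M: "is_leaper M" "M $ 1 < q" "M $ 2 < q"
    and con: "\<And>v w. v \<in> board_of a \<Longrightarrow> w \<in> board_of a \<Longrightarrow> (v, w) \<in> (move_graph p q (board_of a))\<^sup>*"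
  shows "dual (board_of a) M L"
proof -
  define xs where "xs = (a 0 @ a 1 @ a 2 @ a 3 @ a 4 @ a 5 @ a 6) @ a 7"
  have adjM: "adj = leaper_move M" by (intro ext) (simp add: adj_def Mv[symmetric] leaper_move_iff)
  have eight: "{0..<8::int} = {0, 1, 2, 3, 4, 5, 6, 7}" by auto
  have B: "board_of a = set xs" unfolding board_of_def eight xs_def by auto
  have cM: "cyclic_list (leaper_move M) xs" using short_cyclic unfolding adjM xs_def .
  have symM: "leaper_move M x y \<Longrightarrow> leaper_move M y x" for x y using adj_sym unfolding adjM by blast
  have irr: "\<not> leaper_move L x x" for x
    using params by (auto simp: leaper_move_iff L moves_of_eq zero_prod_def)
  have symL: "leaper_move L x y \<Longrightarrow> leaper_move L y x" for x y
    unfolding leaper_move_iff by (metis moves_of_minus_iff minus_diff_eq)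
  have ne: "a 0 \<noteq> []" by (rule nonempty)
  have neB: "board_of a \<noteq> {}" using ne unfolding B xs_def by simp
  have graphL: "{(v, w). v \<in> board_of a \<and> w \<in> board_of a \<and> leaper_move L v w} = move_graph p q (board_of a)"
    by (simp add: move_graph_def leaper_move_iff L)
  have reg: "card {y \<in> board_of a. leaper_move L x y} = 2" if x: "x \<in> board_of a" for x
  proof -
    obtain i where i: "x \<in> set (a i)" using x in_board by blast
    have "{y \<in> board_of a. leaper_move L x y} = {x + value_of p q (mv (i + 3)), x + value_of p q (mv (i + 4))}"
      using long_neighbours[OF i] by (simp add: leaper_move_iff L)
    moreover have "value_of p q (mv (i + 3)) \<noteq> value_of p q (mv (i + 4))"
      using mv_distinct[of "i + 3"] by (simp add: add.assoc)
    ultimately show ?thesis by simp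
  qed
  obtain ys where ys: "cyclic_list (leaper_move L) ys" "set ys = board_of a"
  proof (rule two_regular_connected_cyclic[of "board_of a" "leaper_move L"])
    show "(x, y) \<in> {(x, y). x \<in> board_of a \<and> y \<in> board_of a \<and> leaper_move L x y}\<^sup>*"
      if "x \<in> board_of a" "y \<in> board_of a" for x y using con[OF that] unfolding graphL .
  qed (use B neB irr symL reg in auto)
  have len: "length xs = length ys"
    using cM ys B by (metis cyclic_list_def distinct_card)
  have iso: "digraph_iso (with_proj (leaper_graph M (board_of a))) (with_proj (leaper_graph L (board_of a)))"
    by (rule cyclic_lists_iso[OF cM ys(1) len]) (simp_all add: leaper_graph_def B ys(2))
  have conM: "Digraph_Component.connected (with_proj (leaper_graph M (board_of a)))"
    using connected_leaper_graph[OF neB, of M] cyclic_list_connected[OF cM _ _ symM] unfolding B by blast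
  have conL: "Digraph_Component.connected (with_proj (leaper_graph L (board_of a)))"
    by (rule connected_leaper_graph[OF neB]) (simp add: graphL con)
  have hds: "hd (a 0) \<in> set (a 0)" "hd (a 1) \<in> set (a 1)" using nonempty by simp_all
  then have "hd (a 0) \<in> board_of a" "hd (a 1) \<in> board_of a" using in_board by blast+
  moreover have "hd (a 0) \<noteq> hd (a 1)" using disjoint_next[of "hd (a 0)" 0] hds by auto
  moreover have "is_leaper L" using params L by (auto simp: is_leaper_def vec_eq_iff exI[of _ 1])
  moreover have "\<not> same_leaper M L" using M L by (auto simp: same_leaper_def)
  ultimately show ?thesis unfolding dual_def using M(1) iso conM conL by blast
qed

lemma A_char_mult:
  "(A_char Tf *v x) $ 1 = x $ 1" "(A_char Tf *v x) $ 2 = 2 * x $ 1 + x $ 2"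
  "(A_char Tg *v x) $ 1 = x $ 2" "(A_char Tg *v x) $ 2 = 2 * x $ 2 - x $ 1"
  "(A_char Th *v x) $ 1 = x $ 2" "(A_char Th *v x) $ 2 = x $ 1 + 2 * x $ 2"
  "(A_char Thbar *v x) $ 1 = x $ 2" "(A_char Thbar *v x) $ 2 = x $ 1 + 2 * x $ 2"
  by (simp_all add: matrix_vector_mult_def sum_2)

lemma parameters_Cons: "parameters M k (t # e) = A_char t *v parameters M k e"
  by (simp add: parameters_def matrix_vector_mul_assoc matrix_mul_assoc)

lemma lifted_cycle_invariant:
  assumes M: "M $ 1 = r" "M $ 2 = s" "is_leaper M" "r \<le> s" and ex: "initial_exists M k"
  defines "p \<equiv> \<lambda>e. parameters M k e $ 1" and "q \<equiv> \<lambda>e. parameters M k e $ 2"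
  shows "move_set.lift_invariant (moves_of r s) (lifted_cycle M k e) (p e) (q e) \<and> s < q e \<and>
    (\<forall>v \<in> board_of (lifted_cycle M k e). \<forall>w \<in> board_of (lifted_cycle M k e).
      (v, w) \<in> (move_graph (p e) (q e) (board_of (lifted_cycle M k e)))\<^sup>*)"
proof -
  have rs: "0 \<le> r" "0 < s"
    using M by (auto simp: is_leaper_def vec_eq_iff forall_2)
  then interpret move_set "moves_of r s" by (intro move_set_moves_of) simp
  show ?thesis
  proof (induction e)
    case Nil
    \<comment> \<open>The three types of initial cycle are the same octagon.\<close>
    have "0 < p [] \<and> p [] < q [] \<and> s < q [] \<and> lifted_cycle M k [] = octagon (q [] - p []) (p [])
      \<and> moves_of (p []) (q [] - 2 * p []) = moves_of r s"
      using M ex rs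
      by (cases k) (auto simp: p_def q_def parameters_def A_char_mult moves_of_swap[of s]
          moves_of_minus[of s r, simplified moves_of_swap[of s]] add.commute[of s] simp del: A_char.simps)
    then show ?case
      using octagon_invariant[of "p []" "q []"] octagon_connected[of "p []" "q []"] by auto
  next
    case (Cons t e)
    define P where "P = parameters M k e"
    interpret lifting_step "moves_of r s" "lifted_cycle M k e" "p e" "q e" t P "p (t # e)" "q (t # e)"
    proof unfold_locales
      show "lift_invariant (lifted_cycle M k e) (p e) (q e)" using Cons by blast
      show "lift_params t (p e, q e) = (p (t # e), q (t # e))"
        by (cases t) (simp_all add: p_def q_def parameters_Cons A_char_mult del: A_char.simps)
    qed (simp_all add: P_def p_def q_def)
    have b: "lifted_cycle M k (t # e) = b" by (subst b_def) (simp add: P_def)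
    have "s < q (t # e)"
      using Cons params params' by (cases t) auto
    then show ?case
      unfolding b using b_invariant[OF cones_lift moves_lift] b_connected Cons by blast
  qed
qed

theorem theorem19:
  fixes r s :: int and M :: leaper and k :: type_char and e :: "type_char list"
  assumes "M = vector [r, s]"
    and "is_leaper M"
    and "r \<le> s"
    and "initial_exists M k"
  shows "dual (lifted_board M k e) M (lifted_leaper M k e)"
proof -
  have M: "M $ 1 = r" "M $ 2 = s" using assms(1) by simp_all
  let ?p = "parameters M k e $ 1" and ?q = "parameters M k e $ 2"
  have "r \<noteq> 0 \<or> s \<noteq> 0" using assms(2) M by (auto simp: is_leaper_def vec_eq_iff forall_2)
  then interpret move_set "moves_of r s" by (rule move_set_moves_of)
  note inv = lifted_cycle_invariant[OF M assms(2,3,4), of e]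
  interpret lifted "moves_of r s" "lifted_cycle M k e" ?p ?q
    by (intro lifted.intro lifted_axioms.intro move_set_axioms conjunct1[OF inv])
  have "dual (board_of (lifted_cycle M k e)) M (lifted_leaper M k e)"
  proof (rule dual_board)
    show "M $ 1 < ?q" "M $ 2 < ?q" using conjunct1[OF conjunct2[OF inv]] assms(3) M by simp_all
    show "(v, w) \<in> (move_graph ?p ?q (board_of (lifted_cycle M k e)))\<^sup>*"
      if "v \<in> board_of (lifted_cycle M k e)" "w \<in> board_of (lifted_cycle M k e)" for v w
      using bspec[OF bspec[OF conjunct2[OF conjunct2[OF inv]] that(1)] that(2)] .
  qed (simp_all add: M assms(2) lifted_leaper_def)
  then show ?thesis by (simp add: lifted_board_def board_of_def)
qed

end
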